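(* Let $K$ be a field, let $\lambda = (\lambda_1\ge \cdots\ge \lambda_m)$ be a partition with $\lambda_m\ge m$, put $n=\lambda_1$ and $R=K[x_1,\ldots,x_n]$, and let $I=(x_ix_j \mid 1\le i\le m,\ i\le j\le \lambda_i)\subseteq R$ be the associated strongly stable ideal generated in degree two. Let $\widehat I$ be its LCM-dual. Then the cellular free complex $$\mathcal F_{X_\lambda}:\quad 0 \leftarrow R \xleftarrow{\partial_0} R^\nu(-m-n+2) \xleftarrow{\partial_1} R^\epsilon (-m-n+1) \xleftarrow{\partial_2} R^f(-m-n) \leftarrow 0$$ supported on the labeled polyhedral cell complex $X_\lambda$ is a minimal free resolution of $R/\widehat{I}$.
   Context: LCM-dual: for a monomial ideal $I$ with minimal monomial generators $f_1,\ldots,f_\nu$ and $m_I=\operatorname{lcm}(f_1,\ldots,f_\nu)$, $\widehat I$ is the ideal generated by $m_I/f_1,\ldots,m_I/f_\nu$. For the ideal $I$ here, $m_I=x_1^2\cdots x_m^2x_{m+1}\cdots x_n$ has degree $m+n$. (The ideal $I$ is the specialization $\overline I_{\lambda-\mu}$, obtained by substituting $y_j\mapsto x_j$, of the generalized Ferrers ideal $I_{\lambda-\mu}=(x_iy_j\mid 1\le i\le m,\ i-1<j\le\lambda_i)$ with $\mu=(0,1,\ldots,m-1)$.) The polyhedral complex $X_\lambda$ (a subcomplex of the planar square grid) has: (1) vertices $v_{i,j}$ for $i\le j$ with $x_ix_j\in I$, labeled by the monomial $m_I/(x_ix_j)$; (2) oriented edges $e_{(i,j),(i+1,j)}$ whenever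 $v_{i,j},v_{i+1,j}\in X_\lambda$, and $e_{(i,j),(i,j+1)}$ whenever $v_{i,j},v_{i,j+1}\in X_\lambda$; (3) oriented two-dimensional faces $s_{(i,j),(i+1,j),(i+1,j+1),(i,j+1)}$ whenever $v_{i,j},v_{i+1,j},v_{i+1,j+1},v_{i,j+1}\in X_\lambda$. Each edge or two-dimensional face is labeled by the lcm of the labels of its vertices: $e_{(i,j),(i+1,j)}$ has label $m_I/x_j$, $e_{(i,j),(i,j+1)}$ has label $m_I/x_i$, and every two-dimensional face has label $m_I$. Let $\nu,\epsilon,f$ be the numbers of vertices, edges and two-dimensional faces of $X_\lambda$. The free modules in $\mathcal F_{X_\lambda}$ have bases the vertices, edges and two-dimensional faces respectively, and the differentials are $$\partial_0(v_{i,j}) = m_I/(x_ix_j),$$ $$\partial_1(e_{(i,j),(i+1,j)}) = x_{i}v_{i,j} - x_{i+1}v_{i+1, j},\qquad \partial_1(e_{(i,j),(i,j+1)}) = x_{j}v_{i,j} - x_{j+1}v_{i, j+1},$$ $$\partial_2(s_{(i,j),(i+1,j),(i+1,j+1),(i,j+1)}) = x_i e_{(i,j),(i,j+1)} + x_{j+1}e_{(i,j+1),(i+1,j+1)} - x_{i+1}e_{(i+1,j),(i+1,j+1)}- x_j e_{(i,j),(i+1,j)}.$$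
   Formalization: Minimality is claimed for all partitions except λ = (1) (m = n = 1), where Î = R and ∂₀ is the identity R ← R, so the complex is a free resolution of R/Î = 0 but is not minimal; the resolution claim is kept in that case too. *)

theory Defs
  imports "HOL-Algebra.Algebra" "HOL-Library.Poly_Mapping"
begin

section \<open>Polynomial rings and monomial ideals\<close>

text \<open>
  A power product is its exponent vector \<^typ>\<open>nat \<Rightarrow>\<^sub>0 nat\<close>; a polynomial maps power products to
  coefficients, with the convolution product of \<^theory>\<open>HOL-Library.Poly_Mapping\<close>.
  The ring \<open>K[x\<^sub>1, \<dots>, x\<^sub>n]\<close> consists of the polynomials in which only indices in \<open>{1..n}\<close> occur.
  The order on \<^typ>\<open>nat \<Rightarrow>\<^sub>0 nat\<close> provided by the library is lexicographic, so divisibility of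
  monomials is a separate relation.
\<close>

type_synonym pp = "nat \<Rightarrow>\<^sub>0 nat"
type_synonym 'k pol = "pp \<Rightarrow>\<^sub>0 'k"

definition mon :: "pp \<Rightarrow> 'k::comm_ring_1 pol" where
  "mon t = Poly_Mapping.single t 1"

definition ev :: "nat \<Rightarrow> pp" where
  "ev i = Poly_Mapping.single i 1"

definition var :: "nat \<Rightarrow> 'k::comm_ring_1 pol" where
  "var i = mon (ev i)"

definition mpoly_ring :: "nat \<Rightarrow> 'k::comm_ring_1 pol ring" where
  "mpoly_ring n = \<lparr> carrier = {p. \<forall>t\<in>Poly_Mapping.keys p. Poly_Mapping.keys t \<subseteq> {1..n}},
     monoid.mult = (*), one = 1, ring.zero = 0, add = (+) \<rparr>"

definition tdeg :: "pp \<Rightarrow> nat" where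
  "tdeg t = (\<Sum>k\<in>Poly_Mapping.keys t. Poly_Mapping.lookup t k)"

definition homogeneous :: "'k::zero pol \<Rightarrow> int \<Rightarrow> bool" where
  "homogeneous p d \<longleftrightarrow> (\<forall>t\<in>Poly_Mapping.keys p. int (tdeg t) = d)"

definition pp_dvd :: "pp \<Rightarrow> pp \<Rightarrow> bool" where
  "pp_dvd s t \<longleftrightarrow> (\<forall>k. Poly_Mapping.lookup s k \<le> Poly_Mapping.lookup t k)"

text \<open>Least common multiple of a finite set of monomials; the empty set has lcm \<open>1\<close>.\<close>

definition pp_lcm :: "pp set \<Rightarrow> pp" where
  "pp_lcm G = Abs_poly_mapping (\<lambda>k. Max (insert 0 ((\<lambda>t. Poly_Mapping.lookup t k) ` G)))"

definition is_min_mon_gens :: "'k::comm_ring_1 pol ring \<Rightarrow> 'k pol set \<Rightarrow> pp set \<Rightarrow> bool" where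
  "is_min_mon_gens R J G \<longleftrightarrow>
     mon ` G \<subseteq> carrier R \<and> genideal R (mon ` G) = J \<and> (\<forall>H. H \<subset> G \<longrightarrow> genideal R (mon ` H) \<noteq> J)"

definition min_mon_gens :: "'k::comm_ring_1 pol ring \<Rightarrow> 'k pol set \<Rightarrow> pp set" where
  "min_mon_gens R J = (THE G. is_min_mon_gens R J G)"

definition gens_lcm :: "'k::comm_ring_1 pol ring \<Rightarrow> 'k pol set \<Rightarrow> pp" where
  "gens_lcm R J = pp_lcm (min_mon_gens R J)"

definition lcm_dual :: "'k::comm_ring_1 pol ring \<Rightarrow> 'k pol set \<Rightarrow> 'k pol set" where
  "lcm_dual R J = genideal R ((\<lambda>f. mon (gens_lcm R J - f)) ` min_mon_gens R J)"

definition ferrers_stable_ideal :: "nat \<Rightarrow> (nat \<Rightarrow> nat) \<Rightarrow> 'k::comm_ring_1 pol set" where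
  "ferrers_stable_ideal m lam =
     genideal (mpoly_ring (lam 1)) {var i * var j | i j. 1 \<le> i \<and> i \<le> m \<and> i \<le> j \<and> j \<le> lam i}"


section \<open>Graded free resolutions\<close>

definition mod_hom :: "('r, 'x) ring_scheme \<Rightarrow> ('r, 'a, 'y) module_scheme \<Rightarrow>
    ('r, 'b, 'z) module_scheme \<Rightarrow> ('a \<Rightarrow> 'b) set" where
  "mod_hom R M N = {h. h \<in> carrier M \<rightarrow> carrier N \<and>
     (\<forall>u\<in>carrier M. \<forall>v\<in>carrier M. h (u \<oplus>\<^bsub>M\<^esub> v) = h u \<oplus>\<^bsub>N\<^esub> h v) \<and>
     (\<forall>r\<in>carrier R. \<forall>u\<in>carrier M. h (r \<odot>\<^bsub>M\<^esub> u) = r \<odot>\<^bsub>N\<^esub> h u)}"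

text \<open>
  The free \<open>R\<close>-module on a finite set \<open>B\<close>, as coordinate vectors. The fields \<open>mult\<close> and \<open>one\<close>
  that a module record inherits from rings are irrelevant for modules.
\<close>

definition free_module :: "'k::comm_ring_1 pol ring \<Rightarrow> 'c set \<Rightarrow> ('k pol, 'c \<Rightarrow> 'k pol) module" where
  "free_module R B = \<lparr> carrier = {u. (\<forall>c\<in>B. u c \<in> carrier R) \<and> (\<forall>c. c \<notin> B \<longrightarrow> u c = 0)},
     monoid.mult = (\<lambda>u v. undefined), one = undefined,
     ring.zero = (\<lambda>c. 0), add = (\<lambda>u v c. u c + v c), smult = (\<lambda>r u c. r * u c) \<rparr>"

definition quot_module :: "'r ring \<Rightarrow> 'r set \<Rightarrow> ('r, 'r set) module" where
  "quot_module R J = \<lparr> carrier = carrier (R Quot J),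
     monoid.mult = monoid.mult (R Quot J), one = one (R Quot J),
     ring.zero = ring.zero (R Quot J), add = add (R Quot J),
     smult = (\<lambda>r C. monoid.mult (R Quot J) (J +>\<^bsub>R\<^esub> r) C) \<rparr>"

text \<open>
  The degree \<open>e\<close> part of the twisted free module \<open>R(a)\<^bsup>B\<^esup>\<close>, where \<open>R(a)\<^sub>e = R\<^sub>a\<^sub>+\<^sub>e\<close>.
\<close>

definition graded_part :: "'k::comm_ring_1 pol ring \<Rightarrow> 'c set \<Rightarrow> int \<Rightarrow> int \<Rightarrow> ('c \<Rightarrow> 'k pol) set" where
  "graded_part R B a e = {u \<in> carrier (free_module R B). \<forall>c\<in>B. homogeneous (u c) (a + e)}"

text \<open>
  \<open>F\<^sub>k = R(a k)\<^bsup>B k\<^esup>\<close>, the differentials are \<open>d k : F\<^sub>k\<^sub>+\<^sub>1 \<rightarrow> F\<^sub>k\<close>, and \<open>\<epsilon> : F\<^sub>0 \<rightarrow> M\<close> is the augmentation: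
  the sequence \<open>0 \<leftarrow> M \<leftarrow> F\<^sub>0 \<leftarrow> F\<^sub>1 \<leftarrow> \<dots>\<close> is exact and the \<open>d k\<close> have degree zero.
\<close>

definition graded_free_resolution ::
    "'k::comm_ring_1 pol ring \<Rightarrow> (nat \<Rightarrow> 'c set) \<Rightarrow> (nat \<Rightarrow> int) \<Rightarrow>
     (nat \<Rightarrow> ('c \<Rightarrow> 'k pol) \<Rightarrow> 'c \<Rightarrow> 'k pol) \<Rightarrow>
     (('c \<Rightarrow> 'k pol) \<Rightarrow> 'm) \<Rightarrow> ('k pol, 'm) module \<Rightarrow> bool" where
  "graded_free_resolution R B a d \<epsilon> M \<longleftrightarrow>
     (\<forall>k. finite (B k)) \<and>
     (\<forall>k. d k \<in> mod_hom R (free_module R (B (k + 1))) (free_module R (B k))) \<and>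
     (\<forall>k e. d k ` graded_part R (B (k + 1)) (a (k + 1)) e \<subseteq> graded_part R (B k) (a k) e) \<and>
     (\<forall>k. a_kernel (free_module R (B (k + 1))) (free_module R (B k)) (d k) =
          d (k + 1) ` carrier (free_module R (B (k + 2)))) \<and>
     \<epsilon> \<in> mod_hom R (free_module R (B 0)) M \<and>
     \<epsilon> ` carrier (free_module R (B 0)) = carrier M \<and>
     a_kernel (free_module R (B 0)) M \<epsilon> = d 0 ` carrier (free_module R (B 1))"

text \<open>
  Minimality: each \<open>d k\<close> maps into \<open>\<mm>F\<^sub>k\<close> with \<open>\<mm> = (x\<^sub>1, \<dots>, x\<^sub>n)\<close>; for free modules on finite
  bases, \<open>\<mm>F\<^sub>k\<close> consists of the vectors with all coordinates in \<open>\<mm>\<close>.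
\<close>

definition minimal_complex ::
    "nat \<Rightarrow> (nat \<Rightarrow> 'c set) \<Rightarrow> (nat \<Rightarrow> ('c \<Rightarrow> 'k::comm_ring_1 pol) \<Rightarrow> 'c \<Rightarrow> 'k pol) \<Rightarrow> bool" where
  "minimal_complex n B d \<longleftrightarrow>
     (\<forall>k. \<forall>u\<in>carrier (free_module (mpoly_ring n) (B (k + 1))). \<forall>c.
        d k u c \<in> genideal (mpoly_ring n) (var ` {1..n}))"


section \<open>The labeled cell complex\<close>

text \<open>
  \<open>VEdge i j\<close> is \<open>e\<^bsub>(i,j),(i+1,j)\<^esub>\<close>, \<open>HEdge i j\<close> is \<open>e\<^bsub>(i,j),(i,j+1)\<^esub>\<close>, and \<open>Square i j\<close> is
  \<open>s\<^bsub>(i,j),(i+1,j),(i+1,j+1),(i,j+1)\<^esub>\<close>. The empty cell is the basis element of the free module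
  \<open>R\<close> in homological degree \<open>0\<close>.
\<close>

datatype cell = Empty | Vert nat nat | VEdge nat nat | HEdge nat nat | Square nat nat

fun cell_verts :: "cell \<Rightarrow> (nat \<times> nat) set" where
  "cell_verts Empty = {}"
| "cell_verts (Vert i j) = {(i, j)}"
| "cell_verts (VEdge i j) = {(i, j), (i + 1, j)}"
| "cell_verts (HEdge i j) = {(i, j), (i, j + 1)}"
| "cell_verts (Square i j) = {(i, j), (i + 1, j), (i + 1, j + 1), (i, j + 1)}"

definition X_verts :: "'k::comm_ring_1 pol set \<Rightarrow> (nat \<times> nat) set" where
  "X_verts I = {(i, j). i \<le> j \<and> var i * var j \<in> I}"

text \<open>\<open>X_cells I k\<close> is the set of cells of dimension \<open>k - 1\<close>.\<close>

definition X_cells :: "'k::comm_ring_1 pol set \<Rightarrow> nat \<Rightarrow> cell set" where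
  "X_cells I k = {c. cell_verts c \<subseteq> X_verts I \<and>
     (case c of Empty \<Rightarrow> k = 0 | Vert i j \<Rightarrow> k = 1 | VEdge i j \<Rightarrow> k = 2 | HEdge i j \<Rightarrow> k = 2
        | Square i j \<Rightarrow> k = 3)}"

text \<open>In the following, \<open>mI\<close> is the exponent vector of \<open>m\<^sub>I\<close>.\<close>

definition X_label :: "pp \<Rightarrow> cell \<Rightarrow> pp" where
  "X_label mI c = pp_lcm ((\<lambda>(i, j). mI - (ev i + ev j)) ` cell_verts c)"

definition unit_vec :: "'c \<Rightarrow> 'k::comm_ring_1 pol \<Rightarrow> 'c \<Rightarrow> 'k pol" where
  "unit_vec c p = (\<lambda>c'. if c' = c then p else 0)"

fun X_boundary :: "pp \<Rightarrow> cell \<Rightarrow> cell \<Rightarrow> 'k::comm_ring_1 pol" where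
  "X_boundary mI Empty c = 0"
| "X_boundary mI (Vert i j) c = unit_vec Empty (mon (mI - (ev i + ev j))) c"
| "X_boundary mI (VEdge i j) c =
     unit_vec (Vert i j) (var i) c - unit_vec (Vert (i + 1) j) (var (i + 1)) c"
| "X_boundary mI (HEdge i j) c =
     unit_vec (Vert i j) (var j) c - unit_vec (Vert i (j + 1)) (var (j + 1)) c"
| "X_boundary mI (Square i j) c =
     unit_vec (HEdge i j) (var i) c + unit_vec (VEdge i (j + 1)) (var (j + 1)) c
     - unit_vec (HEdge (i + 1) j) (var (i + 1)) c - unit_vec (VEdge i j) (var j) c"

definition lin_ext :: "'c set \<Rightarrow> ('c \<Rightarrow> 'c \<Rightarrow> 'k::comm_ring_1 pol) \<Rightarrow> ('c \<Rightarrow> 'k pol) \<Rightarrow> 'c \<Rightarrow> 'k pol" where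
  "lin_ext B b u = (\<lambda>c'. \<Sum>c\<in>B. u c * b c c')"

text \<open>
  \<open>X_diff I mI k\<close> is \<open>\<partial>\<^sub>k\<close>, from the module on the \<open>k\<close>-cells to that on the \<open>(k-1)\<close>-cells.
\<close>

definition X_diff :: "'k::comm_ring_1 pol set \<Rightarrow> pp \<Rightarrow> nat \<Rightarrow> (cell \<Rightarrow> 'k pol) \<Rightarrow> cell \<Rightarrow> 'k pol" where
  "X_diff I mI k = lin_ext (X_cells I (k + 1)) (X_boundary mI)"

text \<open>
  A free complex with bases \<open>B k\<close>, twists \<open>a k\<close> and basis boundaries \<open>b\<close> is cellular, supported on
  the cells with vertex sets \<open>vs\<close> and labels \<open>lab\<close>: the basis element of a cell has the degree of
  its label, and the coefficient of \<open>c'\<close> in the boundary of \<open>c\<close> is \<open>\<plusminus> lab c / lab c'\<close> if \<open>c'\<close> is a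
  facet of \<open>c\<close> and \<open>0\<close> otherwise.
\<close>

definition cellular_supported ::
    "(nat \<Rightarrow> 'c set) \<Rightarrow> ('c \<Rightarrow> 'v set) \<Rightarrow> ('c \<Rightarrow> pp) \<Rightarrow> (nat \<Rightarrow> int) \<Rightarrow>
     ('c \<Rightarrow> 'c \<Rightarrow> 'k::comm_ring_1 pol) \<Rightarrow> bool" where
  "cellular_supported B vs lab a b \<longleftrightarrow>
     (\<forall>k. \<forall>c\<in>B k. int (tdeg (lab c)) = - a k) \<and>
     (\<forall>k. \<forall>c\<in>B (k + 1). \<forall>c'\<in>B k.
        if vs c' \<subseteq> vs c
        then pp_dvd (lab c') (lab c) \<and>
             (b c c' = mon (lab c - lab c') \<or> b c c' = - mon (lab c - lab c'))
        else b c c' = 0)"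

end

theory Submission
  imports Defs
begin

text \<open>
  The generators \<open>x\<^sub>i x\<^sub>j\<close> fill a shifted Young diagram: row \<open>i\<close> occupies the columns from \<open>i\<close> to
  \<open>\<lambda>\<^sub>i\<close>, so that with a box off the diagonal its left neighbour is present, and with a box below
  the first row its upper neighbour. They all have degree two, hence none divides another and they
  are the minimal generators; \<open>m\<^sub>I\<close> and all the labels can be read off, and every boundary
  coefficient turns out to be \<open>\<plusminus>\<close> a quotient of labels. Such a coefficient has the degree given by
  the twists, which makes the differentials homogeneous, and it lies in the maximal ideal as soon as
  the twists drop strictly (\<open>cellular_graded\<close>, \<open>cellular_minimal\<close>).

  Exactness has three parts, each with an elementary reason.

  \<^item> At the squares (\<open>d2_injective\<close>) a horizontal edge lies on at most two squares, one above the
    other, so a cycle is constant down each column, and it is zero above the first row.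

  \<^item> At the edges (\<open>ker_d1\<close>) the equation of a vertex off the diagonal is an identity
    \<open>x\<^sub>i A = x\<^sub>j B\<close>, which is solved by \<open>A = x\<^sub>j c\<close> and \<open>B = x\<^sub>i c\<close>. Sums of these \<open>c\<close> over quadrants are
    the coordinates of a chain of squares with the prescribed boundary.

  \<^item> At the vertices (\<open>ker_d0\<close>) the labels have linear quotients when the boxes are read row by row:
    the colon ideal of a label by the earlier ones is generated by the variables that belong to
    the edges towards the left and the upper neighbour. So boundaries of these two edges remove the
    last coordinate of a syzygy.

  The image of the augmented differential is the LCM-dual ideal because that ideal is generated by
  the labels of the vertices (\<open>dual_iff\<close>).
\<close>

section \<open>Polynomials and monomial ideals\<close>

lemma lookup_ev: "Poly_Mapping.lookup (ev i) k = (if k = i then 1 else 0)"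
  by (simp add: ev_def lookup_single when_def)

lemma keys_plus_pp: "Poly_Mapping.keys (s + t) = Poly_Mapping.keys s \<union> Poly_Mapping.keys (t :: pp)"
  by (auto simp: in_keys_iff lookup_add)

lemma keys_ev: "Poly_Mapping.keys (ev i) = {i}"
  by (simp add: ev_def)

lemma sum_monomials: "(\<Sum>t\<in>Poly_Mapping.keys p. Poly_Mapping.single t (Poly_Mapping.lookup p t)) = p"
  by (rule poly_mapping_eqI) (simp add: lookup_sum lookup_single when_def in_keys_iff sum.delta)

lemma mpoly_carrier:
  "p \<in> carrier (mpoly_ring n) \<longleftrightarrow> (\<forall>t\<in>Poly_Mapping.keys p. Poly_Mapping.keys t \<subseteq> {1..n})"
  by (simp add: mpoly_ring_def)

lemma mpoly_ops [simp]:
  "p \<otimes>\<^bsub>mpoly_ring n\<^esub> q = p * q" "p \<oplus>\<^bsub>mpoly_ring n\<^esub> q = p + q"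
  "\<zero>\<^bsub>mpoly_ring n\<^esub> = 0" "\<one>\<^bsub>mpoly_ring n\<^esub> = 1"
  by (simp_all add: mpoly_ring_def)

lemma mpoly_add: "p \<in> carrier (mpoly_ring n) \<Longrightarrow> q \<in> carrier (mpoly_ring n) \<Longrightarrow> p + q \<in> carrier (mpoly_ring n)"
  using keys_add[of p q] by (fastforce simp: mpoly_carrier)

lemma mpoly_mult: "p \<in> carrier (mpoly_ring n) \<Longrightarrow> q \<in> carrier (mpoly_ring n) \<Longrightarrow> p * q \<in> carrier (mpoly_ring n)"
  using keys_mult[of p q] by (fastforce simp: mpoly_carrier keys_plus_pp)

lemma mpoly_uminus: "p \<in> carrier (mpoly_ring n) \<Longrightarrow> - p \<in> carrier (mpoly_ring n)"
  by (simp add: mpoly_carrier in_keys_iff)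

lemma mpoly_diff: "p \<in> carrier (mpoly_ring n) \<Longrightarrow> q \<in> carrier (mpoly_ring n) \<Longrightarrow> p - q \<in> carrier (mpoly_ring n)"
  using mpoly_add[of p n "- q"] mpoly_uminus[of q n] by simp

lemma mpoly_zero: "0 \<in> carrier (mpoly_ring n)"
  and mpoly_one: "1 \<in> carrier (mpoly_ring n)"
  by (auto simp: mpoly_carrier)

lemma mpoly_sum:
  "(\<And>x. x \<in> A \<Longrightarrow> f x \<in> carrier (mpoly_ring n)) \<Longrightarrow> sum f A \<in> carrier (mpoly_ring n)"
  by (induction A rule: infinite_finite_induct) (auto simp: mpoly_zero mpoly_add)

lemma mpoly_single:
  "Poly_Mapping.keys t \<subseteq> {1..n} \<Longrightarrow> Poly_Mapping.single t c \<in> carrier (mpoly_ring n)"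
  by (auto simp: mpoly_carrier)

lemma mpoly_mon_iff [simp]:
  "(mon t :: 'k::comm_ring_1 pol) \<in> carrier (mpoly_ring n) \<longleftrightarrow> Poly_Mapping.keys t \<subseteq> {1..n}"
  by (simp add: mon_def mpoly_carrier)

lemma mpoly_var_iff [simp]: "(var i :: 'k::comm_ring_1 pol) \<in> carrier (mpoly_ring n) \<longleftrightarrow> i \<in> {1..n}"
  by (simp add: var_def keys_ev)

lemmas mpoly_closed = mpoly_add mpoly_mult mpoly_uminus mpoly_diff mpoly_zero mpoly_one mpoly_sum

lemma cring_mpoly: "cring (mpoly_ring n :: 'k::comm_ring_1 pol ring)"
proof (rule cringI)
  show "abelian_group (mpoly_ring n :: 'k pol ring)"
    by (rule abelian_groupI) (auto simp: mpoly_closed intro!: bexI[OF _ mpoly_uminus])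
  show "comm_monoid (mpoly_ring n :: 'k pol ring)"
    by (rule comm_monoidI) (auto simp: mpoly_closed mult_ac)
qed (auto simp: algebra_simps)

lemma ideal_mpolyI:
  fixes J :: "'k::comm_ring_1 pol set"
  assumes "J \<subseteq> carrier (mpoly_ring n)" "0 \<in> J"
    and "\<And>p q. p \<in> J \<Longrightarrow> q \<in> J \<Longrightarrow> p + q \<in> J"
    and mult: "\<And>r p. r \<in> carrier (mpoly_ring n) \<Longrightarrow> p \<in> J \<Longrightarrow> r * p \<in> J"
  shows "ideal J (mpoly_ring n)"
proof -
  interpret cring "mpoly_ring n :: 'k pol ring" by (rule cring_mpoly)
  have neg: "- p \<in> J" if "p \<in> J" for p
    using mult[of "- 1" p] that by (simp add: mpoly_closed)
  have minus: "\<ominus>\<^bsub>mpoly_ring n\<^esub> p = - p" if "p \<in> J" for p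
    using that assms(1) minus_equality[of "- p" p] by (auto simp: mpoly_uminus)
  show ?thesis
  proof (rule idealI)
    show "subgroup J (add_monoid (mpoly_ring n))"
      using assms neg minus by (intro subgroup.intro) (auto simp: a_inv_def)
    show "a \<otimes>\<^bsub>mpoly_ring n\<^esub> x \<in> J" if "a \<in> J" "x \<in> carrier (mpoly_ring n)" for a x
      using mult[OF that(2,1)] by (simp add: mult.commute)
  qed (use mult in \<open>simp_all add: ring_axioms\<close>)
qed

lemma ideal_mpolyD:
  assumes "ideal J (mpoly_ring n :: 'k::comm_ring_1 pol ring)"
  shows "0 \<in> J" "\<And>p q. p \<in> J \<Longrightarrow> q \<in> J \<Longrightarrow> p + q \<in> J"
    and "\<And>r p. r \<in> carrier (mpoly_ring n) \<Longrightarrow> p \<in> J \<Longrightarrow> r * p \<in> J"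
    and "\<And>f A. (\<And>x. x \<in> A \<Longrightarrow> f x \<in> J) \<Longrightarrow> sum f A \<in> J"
proof -
  interpret ideal J "mpoly_ring n" by fact
  show z: "0 \<in> J" using additive_subgroup.zero_closed[OF additive_subgroup_axioms] by simp
  show a: "p + q \<in> J" if "p \<in> J" "q \<in> J" for p q using additive_subgroup.a_closed[OF additive_subgroup_axioms that] by simp
  show "r * p \<in> J" if "r \<in> carrier (mpoly_ring n)" "p \<in> J" for r p using I_l_closed[of p r] that by simp
  show "sum f A \<in> J" if "\<And>x. x \<in> A \<Longrightarrow> f x \<in> J" for f :: "'z \<Rightarrow> 'k pol" and A
    using that by (induction A rule: infinite_finite_induct) (auto simp: z a)
qed

lemma pp_dvd_iff_add: "pp_dvd s t \<longleftrightarrow> (\<exists>u. t = s + u)"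
proof
  assume "pp_dvd s t"
  then have "t = s + (t - s)"
    by (intro poly_mapping_eqI) (simp add: lookup_add lookup_minus pp_dvd_def)
  then show "\<exists>u. t = s + u" ..
qed (auto simp: pp_dvd_def lookup_add)

text \<open>
  The polynomials on the right form an ideal, since a multiple of a monomial divisible by \<open>g\<close> is again
  divisible by \<open>g\<close>. Conversely such a polynomial is the sum of its terms, each a multiple of a generator.
\<close>

lemma genideal_mon:
  fixes G :: "pp set"
  assumes G: "(mon ` G :: 'k::comm_ring_1 pol set) \<subseteq> carrier (mpoly_ring n)"
  shows "genideal (mpoly_ring n) (mon ` G :: 'k pol set) =
    {p \<in> carrier (mpoly_ring n). \<forall>t\<in>Poly_Mapping.keys p. \<exists>g\<in>G. pp_dvd g t}" (is "_ = ?M")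
proof
  interpret cring "mpoly_ring n :: 'k pol ring" by (rule cring_mpoly)
  have "ideal ?M (mpoly_ring n)"
  proof (rule ideal_mpolyI)
    show "p + q \<in> ?M" if "p \<in> ?M" "q \<in> ?M" for p q
      using that keys_add[of p q] by (auto simp: mpoly_closed)
    show "r * p \<in> ?M" if "r \<in> carrier (mpoly_ring n)" "p \<in> ?M" for r p
    proof -
      have "\<exists>g\<in>G. pp_dvd g t" if t: "t \<in> Poly_Mapping.keys (r * p)" for t
      proof -
        from t keys_mult[of r p] obtain a b where "t = a + b" "b \<in> Poly_Mapping.keys p" by auto
        moreover then obtain g where "g \<in> G" "pp_dvd g b" using \<open>p \<in> ?M\<close> by auto
        ultimately show ?thesis
          by (intro bexI[of _ g]) (auto simp: pp_dvd_def lookup_add intro: trans_le_add2)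
      qed
      then show ?thesis using that by (simp add: mpoly_closed)
    qed
  qed (auto simp: mpoly_closed)
  moreover have "mon ` G \<subseteq> ?M"
    using G by (auto simp: mon_def pp_dvd_def)
  ultimately show "genideal (mpoly_ring n) (mon ` G :: 'k pol set) \<subseteq> ?M"
    by (rule genideal_minimal)
  show "?M \<subseteq> genideal (mpoly_ring n) (mon ` G :: 'k pol set)" (is "_ \<subseteq> ?J")
  proof
    fix p assume p: "p \<in> ?M"
    have J: "ideal ?J (mpoly_ring n)" by (rule genideal_ideal[OF G])
    have "Poly_Mapping.single t (Poly_Mapping.lookup p t) \<in> ?J" if t: "t \<in> Poly_Mapping.keys p" for t
    proof -
      from p t obtain g where g: "g \<in> G" "pp_dvd g t" by auto
      then obtain u where u: "t = g + u" by (auto simp: pp_dvd_iff_add)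
      have "Poly_Mapping.keys u \<subseteq> {1..n}"
      proof -
        have "Poly_Mapping.keys (g + u) \<subseteq> {1..n}" using p t u by (simp only: mpoly_carrier) blast
        then show ?thesis by (simp add: keys_plus_pp)
      qed
      moreover have "mon g \<in> ?J" using genideal_self[OF G] g by auto
      ultimately have "Poly_Mapping.single u (Poly_Mapping.lookup p t) * mon g \<in> ?J"
        by (intro ideal_mpolyD(3)[OF J] mpoly_single)
      then show ?thesis by (simp add: mon_def mult_single u add.commute)
    qed
    then have "(\<Sum>t\<in>Poly_Mapping.keys p. Poly_Mapping.single t (Poly_Mapping.lookup p t)) \<in> ?J"
      by (intro ideal_mpolyD(4)[OF J]) auto
    then show "p \<in> ?J" by (simp add: sum_monomials)
  qed
qed

lemma mon_mem_genideal_mon: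
  assumes "(mon ` G :: 'k::comm_ring_1 pol set) \<subseteq> carrier (mpoly_ring n)"
    and "(mon t :: 'k pol) \<in> genideal (mpoly_ring n) (mon ` G)"
  shows "\<exists>g\<in>G. pp_dvd g t"
  using assms(2) unfolding genideal_mon[OF assms(1)] by (simp add: mon_def)

lemma pp_dvd_trans: "pp_dvd s t \<Longrightarrow> pp_dvd t u \<Longrightarrow> pp_dvd s u"
  unfolding pp_dvd_def using le_trans by blast

lemma pp_dvd_antisym: "pp_dvd s t \<Longrightarrow> pp_dvd t s \<Longrightarrow> s = t"
  by (intro poly_mapping_eqI) (simp add: pp_dvd_def le_antisym)

text \<open>
  Let monomials \<open>H\<close> generate the same ideal. Each \<open>g \<in> G\<close> is divisible by some \<open>h \<in> H\<close>, which is
  divisible by some \<open>g' \<in> G\<close>; as \<open>G\<close> is an antichain, \<open>g' = g\<close> and thus \<open>h = g\<close>. Hence \<open>G \<subseteq> H\<close>, which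
  yields the minimality of \<open>G\<close> as well as its uniqueness.
\<close>

lemma min_mon_gens_antichain:
  fixes G :: "pp set"
  assumes G: "(mon ` G :: 'k::comm_ring_1 pol set) \<subseteq> carrier (mpoly_ring n)"
    and anti: "\<And>s t. s \<in> G \<Longrightarrow> t \<in> G \<Longrightarrow> pp_dvd s t \<Longrightarrow> s = t"
  shows "min_mon_gens (mpoly_ring n) (genideal (mpoly_ring n) (mon ` G :: 'k pol set)) = G"
  unfolding min_mon_gens_def
proof (rule the_equality)
  interpret cring "mpoly_ring n :: 'k pol ring" by (rule cring_mpoly)
  let ?J = "genideal (mpoly_ring n) (mon ` G :: 'k pol set)"
  have sub: "G \<subseteq> H" if H: "(mon ` H :: 'k pol set) \<subseteq> carrier (mpoly_ring n)"
    "genideal (mpoly_ring n) (mon ` H :: 'k pol set) = ?J" for H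
  proof
    fix g assume g: "g \<in> G"
    then have "(mon g :: 'k pol) \<in> genideal (mpoly_ring n) (mon ` H)"
      using genideal_self[OF G] H(2) by auto
    then obtain h where h: "h \<in> H" "pp_dvd h g" using mon_mem_genideal_mon[OF H(1)] by blast
    then have "(mon h :: 'k pol) \<in> ?J" using genideal_self[OF H(1)] H(2) by auto
    then obtain g' where g': "g' \<in> G" "pp_dvd g' h" using mon_mem_genideal_mon[OF G] by blast
    have "g' = g" using anti g g' h pp_dvd_trans by blast
    then show "g \<in> H" using g' h pp_dvd_antisym by blast
  qed
  have "genideal (mpoly_ring n) (mon ` H :: 'k pol set) \<noteq> ?J" if "H \<subset> G" for H
  proof
    assume "genideal (mpoly_ring n) (mon ` H :: 'k pol set) = ?J"
    moreover have "(mon ` H :: 'k pol set) \<subseteq> carrier (mpoly_ring n)"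
      using G that by blast
    ultimately show False using sub that by blast
  qed
  then show "is_min_mon_gens (mpoly_ring n) ?J G"
    using G by (simp add: is_min_mon_gens_def)
  show "H = G" if "is_min_mon_gens (mpoly_ring n) ?J H" for H
  proof (rule ccontr)
    assume "H \<noteq> G"
    moreover have "G \<subseteq> H" using that by (intro sub) (simp_all only: is_min_mon_gens_def)
    ultimately have "G \<subset> H" by blast
    then show False using that unfolding is_min_mon_gens_def by blast
  qed
qed

lemma lookup_pp_lcm:
  assumes "finite G"
  shows "Poly_Mapping.lookup (pp_lcm G) k = Max (insert 0 ((\<lambda>t. Poly_Mapping.lookup t k) ` G))"
proof -
  have "Max (insert 0 ((\<lambda>t. Poly_Mapping.lookup t k) ` G)) = 0"
    if "k \<notin> (\<Union>t\<in>G. Poly_Mapping.keys t)" for k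
  proof -
    have "insert 0 ((\<lambda>t. Poly_Mapping.lookup t k) ` G) = {0}"
      using that by (auto simp: in_keys_iff)
    then show ?thesis by (simp only: Max_singleton)
  qed
  then have "{k. Max (insert 0 ((\<lambda>t. Poly_Mapping.lookup t k) ` G)) \<noteq> 0} \<subseteq> (\<Union>t\<in>G. Poly_Mapping.keys t)"
    by (simp only: subset_iff mem_Collect_eq) metis
  then have "finite {k. Max (insert 0 ((\<lambda>t. Poly_Mapping.lookup t k) ` G)) \<noteq> 0}"
    by (rule finite_subset) (simp add: assms)
  then show ?thesis unfolding pp_lcm_def by (simp add: Abs_poly_mapping_inverse)
qed

lemma tdeg_eq_sum: "finite A \<Longrightarrow> Poly_Mapping.keys t \<subseteq> A \<Longrightarrow> tdeg t = (\<Sum>k\<in>A. Poly_Mapping.lookup t k)"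
  unfolding tdeg_def by (rule sum.mono_neutral_left) (auto simp: in_keys_iff)

lemma tdeg_add: "tdeg (s + t) = tdeg s + tdeg t"
  using tdeg_eq_sum[of "Poly_Mapping.keys s \<union> Poly_Mapping.keys t" "s + t"]
    tdeg_eq_sum[of "Poly_Mapping.keys s \<union> Poly_Mapping.keys t" s]
    tdeg_eq_sum[of "Poly_Mapping.keys s \<union> Poly_Mapping.keys t" t]
  by (simp add: keys_plus_pp lookup_add sum.distrib)

lemma tdeg_ev [simp]: "tdeg (ev i) = 1"
  by (simp add: tdeg_def keys_ev lookup_ev)

lemma tdeg_diff: "pp_dvd s t \<Longrightarrow> tdeg (t - s) = tdeg t - tdeg s"
  by (auto simp: pp_dvd_iff_add tdeg_add)

lemma pp_dvd_tdeg_eq: "pp_dvd s t \<Longrightarrow> tdeg s = tdeg t \<Longrightarrow> s = t"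
proof -
  assume "pp_dvd s t" "tdeg s = tdeg t"
  then obtain u where u: "t = s + u" "tdeg u = 0" by (auto simp: pp_dvd_iff_add tdeg_add)
  then have "Poly_Mapping.lookup u k = 0" for k
    by (cases "k \<in> Poly_Mapping.keys u") (auto simp: tdeg_def in_keys_iff)
  then show ?thesis using u by (auto intro: poly_mapping_eqI simp: lookup_add)
qed

lemma lookup_mon_mult: "Poly_Mapping.lookup (p * mon s) (t + s) = Poly_Mapping.lookup (p :: 'k::comm_ring_1 pol) t"
proof -
  have "p * mon s = (\<Sum>u\<in>Poly_Mapping.keys p. Poly_Mapping.single (u + s) (Poly_Mapping.lookup p u))"
    by (subst (1) sum_monomials[symmetric]) (simp add: sum_distrib_right mon_def mult_single)
  then show ?thesis
    by (simp add: lookup_sum lookup_single when_def in_keys_iff sum.delta)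
qed

lemma var_mult_mon: "(var i * mon s :: 'k::comm_ring_1 pol) = mon (ev i + s)"
  by (simp add: var_def mon_def mult_single)

lemma var_mult_var: "(var i * var j :: 'k::comm_ring_1 pol) = mon (ev i + ev j)"
  by (simp add: var_def mon_def mult_single)

lemma key_mult_mon:
  assumes "t \<in> Poly_Mapping.keys (p * mon s :: 'k::comm_ring_1 pol)"
  shows "pp_dvd s t"
  using keys_mult[of p "mon s"] assms by (auto simp: mon_def pp_dvd_iff_add add.commute)

text \<open>
  A term goes to \<open>q\<close> whenever it is divisible by \<open>x\<^sub>i\<close>, so \<open>r\<close> only collects the terms that are not.
  The case \<open>i = j\<close> is division by a single variable.
\<close>

lemma split_two_variables:
  fixes p :: "'k::comm_ring_1 pol"
  assumes p: "p \<in> carrier (mpoly_ring n)"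
    and key: "\<And>t. t \<in> Poly_Mapping.keys p \<Longrightarrow> Poly_Mapping.lookup t i > 0 \<or> Poly_Mapping.lookup t j > 0"
  obtains q r where "q \<in> carrier (mpoly_ring n)" "r \<in> carrier (mpoly_ring n)"
    "p = var i * q + var j * r" "(\<And>t. t \<in> Poly_Mapping.keys p \<Longrightarrow> Poly_Mapping.lookup t i > 0) \<Longrightarrow> r = 0"
proof -
  let ?A = "{t \<in> Poly_Mapping.keys p. Poly_Mapping.lookup t i > 0}"
  let ?B = "{t \<in> Poly_Mapping.keys p. Poly_Mapping.lookup t i = 0}"
  define q where "q = (\<Sum>t\<in>?A. Poly_Mapping.single (t - ev i) (Poly_Mapping.lookup p t))"
  define r where "r = (\<Sum>t\<in>?B. Poly_Mapping.single (t - ev j) (Poly_Mapping.lookup p t))"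
  have ev: "ev k + (t - ev k) = t" if "Poly_Mapping.lookup t k > 0" for t k
    using that by (intro poly_mapping_eqI) (auto simp: lookup_add lookup_minus lookup_ev)
  have keys: "Poly_Mapping.keys (t - ev k) \<subseteq> {1..n}" if "t \<in> Poly_Mapping.keys p" for t k
  proof -
    have "Poly_Mapping.keys (t - ev k) \<subseteq> Poly_Mapping.keys t"
      by (auto simp: in_keys_iff lookup_minus)
    then show ?thesis using p that by (auto simp: mpoly_carrier)
  qed
  have "var i * q = (\<Sum>t\<in>?A. Poly_Mapping.single t (Poly_Mapping.lookup p t))"
    unfolding q_def sum_distrib_left
    by (intro sum.cong refl) (simp add: var_def mon_def mult_single ev)
  moreover have "var j * r = (\<Sum>t\<in>?B. Poly_Mapping.single t (Poly_Mapping.lookup p t))"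
    unfolding r_def sum_distrib_left
    by (intro sum.cong refl) (use key in \<open>fastforce simp: var_def mon_def mult_single ev\<close>)
  moreover have "p = (\<Sum>t\<in>?A \<union> ?B. Poly_Mapping.single t (Poly_Mapping.lookup p t))"
    by (subst sum_monomials[symmetric]) (rule sum.cong; auto)
  ultimately have "p = var i * q + var j * r"
    by (subst (asm) sum.union_disjoint) auto
  moreover have "r = 0" if "\<And>t. t \<in> Poly_Mapping.keys p \<Longrightarrow> Poly_Mapping.lookup t i > 0"
  proof -
    have "?B = {}" using that by auto
    then show ?thesis by (simp only: r_def sum.empty)
  qed
  moreover have "q \<in> carrier (mpoly_ring n)" "r \<in> carrier (mpoly_ring n)"
    by (auto simp: q_def r_def intro!: mpoly_sum mpoly_single keys[THEN subsetD])
  ultimately show ?thesis using that by blast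
qed

lemma var_nonzero [simp]: "(var k :: 'k::comm_ring_1 pol) \<noteq> 0"
  by (metis keys_single keys_zero mon_def var_def zero_neq_one insert_not_empty)

text \<open>
  Distinct variables are coprime: multiplying a monomial by \<open>x\<^sub>i\<close> does not change its exponent at \<open>j\<close>,
  so every term of \<open>y\<close> is already divisible by \<open>x\<^sub>j\<close>.
\<close>

lemma var_cross_multiple:
  fixes y z :: "'k::field pol"
  assumes "i \<noteq> j" and y: "y \<in> carrier (mpoly_ring n)" and eq: "var i * y = var j * z"
  obtains c where "c \<in> carrier (mpoly_ring n)" "y = var j * c" "z = var i * c"
proof -
  have dvd: "Poly_Mapping.lookup t j > 0" if t: "t \<in> Poly_Mapping.keys y" for t
  proof -
    have "Poly_Mapping.lookup (y * mon (ev i)) (t + ev i) \<noteq> 0"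
      using t by (simp add: lookup_mon_mult in_keys_iff)
    then have "t + ev i \<in> Poly_Mapping.keys (z * mon (ev j))"
      using eq by (simp add: in_keys_iff var_def mult.commute)
    then have "pp_dvd (ev j) (t + ev i)" by (rule key_mult_mon)
    then have "Poly_Mapping.lookup (ev j) j \<le> Poly_Mapping.lookup (t + ev i) j" by (simp add: pp_dvd_def)
    then show ?thesis using \<open>i \<noteq> j\<close> by (simp add: lookup_add lookup_ev)
  qed
  then obtain c r where c: "c \<in> carrier (mpoly_ring n)" "y = var j * c + var j * r" "r = 0"
    using split_two_variables[OF y, of j j] by metis
  then have "var j * z = var j * (var i * c)" using eq by (metis add.right_neutral mult.left_commute mult_zero_right)
  then have "z = var i * c" using mult_left_cancel var_nonzero by metis
  with c that show ?thesis by simp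
qed

lemma pp_diff_diff:
  fixes s t u :: pp
  shows "pp_dvd (s + t) u \<Longrightarrow> (u - t) - (u - (s + t)) = s"
proof (rule poly_mapping_eqI)
  fix k assume "pp_dvd (s + t) u"
  then have "Poly_Mapping.lookup s k + Poly_Mapping.lookup t k \<le> Poly_Mapping.lookup u k"
    by (simp add: pp_dvd_def lookup_add)
  then show "Poly_Mapping.lookup ((u - t) - (u - (s + t))) k = Poly_Mapping.lookup s k"
    by (simp add: lookup_minus lookup_add)
qed

section \<open>Free modules and cellular complexes\<close>

lemma free_carrier:
  "u \<in> carrier (free_module R B) \<longleftrightarrow> (\<forall>c\<in>B. u c \<in> carrier R) \<and> (\<forall>c. c \<notin> B \<longrightarrow> u c = 0)"
  by (simp add: free_module_def)

lemma free_module_ops [simp]: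
  "u \<oplus>\<^bsub>free_module R B\<^esub> v = (\<lambda>c. u c + v c)" "r \<odot>\<^bsub>free_module R B\<^esub> u = (\<lambda>c. r * u c)"
  "\<zero>\<^bsub>free_module R B\<^esub> = (\<lambda>c. 0)"
  by (simp_all add: free_module_def)

lemma free_coord: "u \<in> carrier (free_module (mpoly_ring n) B) \<Longrightarrow> u c \<in> carrier (mpoly_ring n)"
  by (cases "c \<in> B") (auto simp: free_carrier mpoly_zero)

lemma free_add: "u \<in> carrier (free_module (mpoly_ring n) B) \<Longrightarrow> v \<in> carrier (free_module (mpoly_ring n) B) \<Longrightarrow>
    (\<lambda>c. u c + v c) \<in> carrier (free_module (mpoly_ring n) B)"
  and free_diff: "u \<in> carrier (free_module (mpoly_ring n) B) \<Longrightarrow> v \<in> carrier (free_module (mpoly_ring n) B) \<Longrightarrow>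
    (\<lambda>c. u c - v c) \<in> carrier (free_module (mpoly_ring n) B)"
  and free_smult: "r \<in> carrier (mpoly_ring n) \<Longrightarrow> v \<in> carrier (free_module (mpoly_ring n) B) \<Longrightarrow>
    (\<lambda>c. r * v c) \<in> carrier (free_module (mpoly_ring n) B)"
  by (auto simp: free_carrier mpoly_closed)

lemma free_unit:
  "(c \<in> B \<and> p \<in> carrier (mpoly_ring n)) \<or> p = 0 \<Longrightarrow> unit_vec c p \<in> carrier (free_module (mpoly_ring n) B)"
  by (auto simp: free_carrier unit_vec_def mpoly_zero)

lemma lin_ext_closed:
  assumes "\<And>c. c \<in> B' \<Longrightarrow> b c \<in> carrier (free_module (mpoly_ring n) B)"
    and "u \<in> carrier (free_module (mpoly_ring n) B')"
  shows "lin_ext B' b u \<in> carrier (free_module (mpoly_ring n) B)"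
proof -
  have "(\<Sum>c\<in>B'. u c * b c c') \<in> carrier (mpoly_ring n)" for c'
    by (intro mpoly_sum mpoly_mult free_coord[OF assms(1)] free_coord[OF assms(2)])
  moreover have "(\<Sum>c\<in>B'. u c * b c c') = 0" if "c' \<notin> B" for c'
    using assms(1) that by (intro sum.neutral) (auto simp: free_carrier)
  ultimately show ?thesis by (auto simp: free_carrier lin_ext_def)
qed

lemma lin_ext_add: "lin_ext B b (\<lambda>c. u c + v c) = (\<lambda>c. lin_ext B b u c + lin_ext B b v c)"
  and lin_ext_diff: "lin_ext B b (\<lambda>c. u c - v c) = (\<lambda>c. lin_ext B b u c - lin_ext B b v c)"
  and lin_ext_smult: "lin_ext B b (\<lambda>c. r * u c) = (\<lambda>c. r * lin_ext B b u c)"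
  by (auto simp: lin_ext_def sum.distrib sum_subtractf sum_distrib_left algebra_simps)

lemma lin_ext_mod_hom:
  assumes "\<And>c. c \<in> B' \<Longrightarrow> b c \<in> carrier (free_module (mpoly_ring n) B)"
  shows "lin_ext B' b \<in> mod_hom (mpoly_ring n) (free_module (mpoly_ring n) B') (free_module (mpoly_ring n) B)"
  unfolding mod_hom_def using lin_ext_closed[OF assms] by (auto simp: lin_ext_add lin_ext_smult)

lemma lin_ext_unit:
  "finite B \<Longrightarrow> c \<in> B \<or> p = 0 \<Longrightarrow> lin_ext B b (unit_vec c p) = (\<lambda>c'. p * b c c')"
  by (auto simp: lin_ext_def unit_vec_def if_distrib[of "\<lambda>x. x * _"] sum.delta cong: if_cong)

lemma lin_ext_lin_ext: "lin_ext B b (lin_ext B' b' u) = lin_ext B' (\<lambda>c. lin_ext B b (b' c)) u"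
  unfolding lin_ext_def sum_distrib_right sum_distrib_left
  by (subst sum.swap) (simp add: mult.assoc)

text \<open>
  The set \<open>F\<close> lists the basis elements that may have \<open>c'\<close> in their boundary. It need not be contained
  in \<open>B\<close>; this way the coordinate formulas for the differentials below hold without case distinctions
  at the border of the complex.
\<close>

lemma lin_ext_coord:
  assumes "finite B" "finite F" "\<And>c. c \<notin> B \<Longrightarrow> u c = 0" "\<And>c. c \<in> B \<Longrightarrow> c \<notin> F \<Longrightarrow> b c c' = 0"
  shows "lin_ext B b u c' = (\<Sum>c\<in>F. u c * b c c')"
proof -
  have "(\<Sum>c\<in>B. u c * b c c') = (\<Sum>c\<in>B \<inter> F. u c * b c c')"
    using assms by (intro sum.mono_neutral_right) auto
  also have "\<dots> = (\<Sum>c\<in>F. u c * b c c')"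
    using assms(1,2) by (intro sum.mono_neutral_left) (use assms(3) in force)+
  finally show ?thesis by (simp add: lin_ext_def)
qed

lemma homogeneous_zero [simp]: "homogeneous 0 d"
  by (simp add: homogeneous_def)

lemma homogeneous_add: "homogeneous p d \<Longrightarrow> homogeneous q d \<Longrightarrow> homogeneous (p + q) d"
  using keys_add[of p q] by (auto simp: homogeneous_def)

lemma homogeneous_sum: "(\<And>x. x \<in> A \<Longrightarrow> homogeneous (f x) d) \<Longrightarrow> homogeneous (sum f A) d"
  by (induction A rule: infinite_finite_induct) (auto intro: homogeneous_add)

lemma homogeneous_mult:
  "homogeneous (p :: 'k::comm_ring_1 pol) d \<Longrightarrow> homogeneous q e \<Longrightarrow> homogeneous (p * q) (d + e)"
  using keys_mult[of p q] by (fastforce simp: homogeneous_def tdeg_add)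

lemma homogeneous_mon: "homogeneous (mon t :: 'k::comm_ring_1 pol) (int (tdeg t))"
  and homogeneous_minus_mon: "homogeneous (- mon t :: 'k::comm_ring_1 pol) (int (tdeg t))"
  by (simp_all add: homogeneous_def mon_def single_uminus[symmetric])

text \<open>
  The labels of a cell and of its facets have degrees prescribed by the twists, so the degree of a
  boundary coefficient depends on the homological degree only.
\<close>

lemma cellular_coefficient:
  assumes "cellular_supported B vs lab a b" "c \<in> B (k + 1)" "c' \<in> B k"
  obtains "b c c' = 0" | t where "b c c' = mon t \<or> b c c' = - mon t" "int (tdeg t) = a k - a (k + 1)"
proof (cases "vs c' \<subseteq> vs c")
  case True
  then have *: "pp_dvd (lab c') (lab c)"
    "b c c' = mon (lab c - lab c') \<or> b c c' = - mon (lab c - lab c')"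
    using assms unfolding cellular_supported_def by auto
  have "int (tdeg (lab c)) = - a (k + 1)" "int (tdeg (lab c')) = - a k"
    using assms unfolding cellular_supported_def by auto
  moreover have "tdeg (lab c) = tdeg (lab c') + tdeg (lab c - lab c')"
    using *(1) by (auto simp: pp_dvd_iff_add tdeg_add)
  ultimately have "int (tdeg (lab c - lab c')) = a k - a (k + 1)" by linarith
  with * that show ?thesis by blast
next
  case False
  then have "b c c' = 0" using assms unfolding cellular_supported_def by auto
  with that show ?thesis by blast
qed

lemma cellular_graded:
  fixes b :: "'c \<Rightarrow> 'c \<Rightarrow> 'k::comm_ring_1 pol"
  assumes cell: "cellular_supported B vs lab a b"
    and cl: "\<And>c. c \<in> B (k + 1) \<Longrightarrow> b c \<in> carrier (free_module (mpoly_ring n) (B k))"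
  shows "lin_ext (B (k + 1)) b ` graded_part (mpoly_ring n) (B (k + 1)) (a (k + 1)) e
    \<subseteq> graded_part (mpoly_ring n) (B k) (a k) e"
proof clarify
  fix u :: "'c \<Rightarrow> 'k pol" assume u: "u \<in> graded_part (mpoly_ring n) (B (k + 1)) (a (k + 1)) e"
  have "homogeneous (lin_ext (B (k + 1)) b u c') (a k + e)" if c': "c' \<in> B k" for c'
    unfolding lin_ext_def
  proof (rule homogeneous_sum)
    fix c assume c: "c \<in> B (k + 1)"
    have uc: "homogeneous (u c) (a (k + 1) + e)" using u c by (simp add: graded_part_def)
    from cell c c' show "homogeneous (u c * b c c') (a k + e)"
    proof (cases rule: cellular_coefficient)
      case (2 t)
      then have "homogeneous (b c c') (a k - a (k + 1))"
        using homogeneous_mon[of t] homogeneous_minus_mon[of t] by auto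
      from homogeneous_mult[OF uc this] show ?thesis by (simp add: add.commute)
    qed simp
  qed
  then show "lin_ext (B (k + 1)) b u \<in> graded_part (mpoly_ring n) (B k) (a k) e"
    using u lin_ext_closed[OF cl] by (auto simp: graded_part_def)
qed

text \<open>
  A boundary coefficient that is not zero is \<open>\<plusminus>\<close> a monomial of degree \<open>a k - a (k + 1)\<close>. If this is
  positive, some variable divides the monomial.
\<close>

lemma cellular_minimal:
  assumes cell: "cellular_supported B vs lab a b"
    and cl: "\<And>k c. c \<in> B (k + 1) \<Longrightarrow> b c \<in> carrier (free_module (mpoly_ring n) (B k))"
    and strict: "\<And>k. B (k + 1) \<noteq> {} \<Longrightarrow> a (k + 1) < a k"
  shows "minimal_complex n B (\<lambda>k. lin_ext (B (k + 1)) (b :: _ \<Rightarrow> _ \<Rightarrow> 'k::comm_ring_1 pol))"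
  unfolding minimal_complex_def
proof (intro allI ballI)
  fix k c' u assume u: "u \<in> carrier (free_module (mpoly_ring n :: 'k pol ring) (B (k + 1)))"
  interpret cring "mpoly_ring n :: 'k pol ring" by (rule cring_mpoly)
  have sub: "(mon ` ev ` {1..n} :: 'k pol set) \<subseteq> carrier (mpoly_ring n)"
    by (auto simp: keys_ev)
  have var: "(var ` {1..n} :: 'k pol set) = mon ` ev ` {1..n}"
    by (auto simp: var_def)
  let ?M = "genideal (mpoly_ring n) (var ` {1..n} :: 'k pol set)"
  have M: "ideal ?M (mpoly_ring n)" unfolding var by (rule genideal_ideal[OF sub])
  have "u c * b c c' \<in> ?M" if c: "c \<in> B (k + 1)" for c
  proof (intro ideal_mpolyD(3)[OF M] free_coord[OF u])
    show "b c c' \<in> ?M"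
    proof (cases "c' \<in> B k")
      case True
      from cell c True show ?thesis
      proof (cases rule: cellular_coefficient)
        case 1 then show ?thesis using ideal_mpolyD(1)[OF M] by simp
      next
        case (2 t)
        have "a (k + 1) < a k" using strict c by blast
        with 2 have "tdeg t \<noteq> 0" by linarith
        then obtain i where i: "i \<in> Poly_Mapping.keys t" by (auto simp: tdeg_def)
        have bc: "Poly_Mapping.keys (b c c') = {t}"
          using 2 by (auto simp: mon_def single_uminus[symmetric])
        have "b c c' \<in> carrier (mpoly_ring n)" using free_coord[OF cl[OF c]] .
        moreover from this have "Poly_Mapping.keys t \<subseteq> {1..n}" using bc by (auto simp: mpoly_carrier)
        with i have "i \<in> {1..n}" by blast
        moreover have "pp_dvd (ev i) t" using i by (auto simp: pp_dvd_def lookup_ev in_keys_iff)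
        ultimately show ?thesis unfolding var genideal_mon[OF sub] bc mem_Collect_eq by blast
      qed
    next
      case False
      then have "b c c' = 0" using cl[OF c] by (simp add: free_carrier)
      then show ?thesis using ideal_mpolyD(1)[OF M] by simp
    qed
  qed
  then show "lin_ext (B (k + 1)) b u c' \<in> ?M"
    unfolding lin_ext_def by (rule ideal_mpolyD(4)[OF M])
qed

section \<open>The shifted diagram and its labels\<close>

locale ferrers_shape =
  fixes m n :: nat and lam :: "nat \<Rightarrow> nat"
  assumes n_eq: "n = lam 1"
    and m_pos: "1 \<le> m"
    and lam_antimono: "\<And>i j. 1 \<le> i \<Longrightarrow> i \<le> j \<Longrightarrow> j \<le> m \<Longrightarrow> lam j \<le> lam i"
    and m_le_lam: "m \<le> lam m"
begin

text \<open>
  A shifted Young diagram: row \<open>i\<close> starts on the diagonal.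
\<close>

definition shape :: "(nat \<times> nat) set" where
  "shape = {(i, j). 1 \<le> i \<and> i \<le> m \<and> i \<le> j \<and> j \<le> lam i}"

definition gens :: "pp set" where
  "gens = (\<lambda>(i, j). ev i + ev j) ` shape"

definition L :: pp where "L = pp_lcm gens"

text \<open>
  The cells depend on the ideal only through its diagram. Built from the diagram, they do not involve
  a coefficient field.
\<close>

definition cells :: "nat \<Rightarrow> cell set" where
  "cells k = {c. cell_verts c \<subseteq> shape \<and>
     (case c of Empty \<Rightarrow> k = 0 | Vert i j \<Rightarrow> k = 1 | VEdge i j \<Rightarrow> k = 2 | HEdge i j \<Rightarrow> k = 2
        | Square i j \<Rightarrow> k = 3)}"

lemma shape_iff: "(i, j) \<in> shape \<longleftrightarrow> 1 \<le> i \<and> i \<le> m \<and> i \<le> j \<and> j \<le> lam i"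
  by (simp add: shape_def)

lemma shape_le_n: "(i, j) \<in> shape \<Longrightarrow> j \<le> n"
  using lam_antimono[of 1 i] n_eq by (auto simp: shape_iff)

lemma m_le_n: "m \<le> n"
  using lam_antimono[of 1 m] m_pos m_le_lam n_eq by simp

lemma m_le_lam': "1 \<le> i \<Longrightarrow> i \<le> m \<Longrightarrow> m \<le> lam i"
  using lam_antimono[of i m] m_le_lam by simp

lemma finite_shape: "finite shape"
proof (rule finite_subset)
  show "shape \<subseteq> {1..m} \<times> {1..n}"
    by (clarify, frule shape_le_n) (auto simp: shape_iff)
qed simp

lemma shape_up: "(i + 1, j) \<in> shape \<Longrightarrow> 1 \<le> i \<Longrightarrow> (i, j) \<in> shape"
  using lam_antimono[of i "i + 1"] by (auto simp: shape_iff)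

lemma shape_left: "(i, j + 1) \<in> shape \<Longrightarrow> i \<le> j \<Longrightarrow> (i, j) \<in> shape"
  by (auto simp: shape_iff)

lemma cells_iff [simp]:
  "Empty \<in> cells k \<longleftrightarrow> k = 0"
  "Vert i j \<in> cells k \<longleftrightarrow> k = 1 \<and> (i, j) \<in> shape"
  "VEdge i j \<in> cells k \<longleftrightarrow> k = 2 \<and> (i, j) \<in> shape \<and> (i + 1, j) \<in> shape"
  "HEdge i j \<in> cells k \<longleftrightarrow> k = 2 \<and> (i, j) \<in> shape \<and> (i, j + 1) \<in> shape"
  "Square i j \<in> cells k \<longleftrightarrow> k = 3 \<and> (i, j) \<in> shape \<and> (i + 1, j) \<in> shape \<and>
     (i + 1, j + 1) \<in> shape \<and> (i, j + 1) \<in> shape"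
  by (auto simp: cells_def)

text \<open>
  The lower right corner of a square determines the others: row \<open>i\<close> is at least as long as row \<open>i + 1\<close>,
  and \<open>i < j\<close> keeps the lower left corner on or above the diagonal.
\<close>

lemma Square_cell: "Square i j \<in> cells 3 \<longleftrightarrow> 1 \<le> i \<and> i < j \<and> (i + 1, j + 1) \<in> shape"
  using shape_up[of i j] shape_up[of i "j + 1"] shape_left[of "i + 1" j]
  by (auto simp: shape_iff)

lemma cells_0: "cells 0 = {Empty}"
  and cells_ge_4: "4 \<le> k \<Longrightarrow> cells k = {}"
  unfolding set_eq_iff by (rule_tac [!] allI, case_tac [!] x) auto

lemma finite_cells: "finite (cells k)"
proof (rule finite_subset)
  let ?f = "\<lambda>(h :: nat \<Rightarrow> nat \<Rightarrow> cell). (\<lambda>x. h (fst x) (snd x)) ` shape"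
  show "cells k \<subseteq> insert Empty (?f Vert \<union> ?f VEdge \<union> ?f HEdge \<union> ?f Square)"
  proof
    fix c assume "c \<in> cells k"
    then show "c \<in> insert Empty (?f Vert \<union> ?f VEdge \<union> ?f HEdge \<union> ?f Square)"
      by (cases c) (force simp: image_iff)+
  qed
qed (simp add: finite_shape)

lemma gens_carrier: "(mon ` gens :: 'k::comm_ring_1 pol set) \<subseteq> carrier (mpoly_ring n)"
  using shape_le_n by (fastforce simp: gens_def shape_iff keys_plus_pp keys_ev)

lemma gens_antichain: "s \<in> gens \<Longrightarrow> t \<in> gens \<Longrightarrow> pp_dvd s t \<Longrightarrow> s = t"
  by (rule pp_dvd_tdeg_eq) (auto simp: gens_def tdeg_add)

lemma finite_gens: "finite gens"
  by (simp add: gens_def finite_shape)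

lemma ferrers_ideal_eq:
  "(ferrers_stable_ideal m lam :: 'k::comm_ring_1 pol set) = genideal (mpoly_ring n) (mon ` gens)"
proof -
  have "{var i * var j | i j. 1 \<le> i \<and> i \<le> m \<and> i \<le> j \<and> j \<le> lam i} =
      ((\<lambda>(i, j). var i * var j) ` shape :: 'k pol set)"
    by (auto simp: shape_def)
  also have "\<dots> = mon ` gens"
    unfolding gens_def image_image by (rule image_cong) (auto simp: var_mult_var)
  finally have "{var i * var j | i j. 1 \<le> i \<and> i \<le> m \<and> i \<le> j \<and> j \<le> lam i} = (mon ` gens :: 'k pol set)" .
  then show ?thesis unfolding ferrers_stable_ideal_def n_eq by (rule arg_cong)
qed

lemma min_gens: "min_mon_gens (mpoly_ring n) (ferrers_stable_ideal m lam :: 'k::comm_ring_1 pol set) = gens"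
  unfolding ferrers_ideal_eq by (rule min_mon_gens_antichain[OF gens_carrier gens_antichain])

lemma gens_lcm_eq: "gens_lcm (mpoly_ring n) (ferrers_stable_ideal m lam :: 'k::comm_ring_1 pol set) = L"
  by (simp add: gens_lcm_def min_gens L_def)

lemma ev_pair_eq:
  assumes "i \<le> j" "a \<le> b" "ev i + ev j = ev a + ev b"
  shows "i = a \<and> j = b"
proof -
  have "{i, j} = {a, b}"
    using arg_cong[OF assms(3), of Poly_Mapping.keys] by (simp add: keys_plus_pp keys_ev insert_commute)
  with assms(1,2) show ?thesis by (auto simp: doubleton_eq_iff)
qed

text \<open>
  All generators have degree two, so a monomial of degree two in the ideal is divisible by a generator
  of the same degree and therefore equal to it.
\<close>

lemma X_verts_eq: "X_verts (ferrers_stable_ideal m lam :: 'k::comm_ring_1 pol set) = shape"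
proof -
  interpret cring "mpoly_ring n :: 'k pol ring" by (rule cring_mpoly)
  have shapeI: "(i, j) \<in> shape" if "i \<le> j" "(mon (ev i + ev j) :: 'k pol) \<in> genideal (mpoly_ring n) (mon ` gens)" for i j
  proof -
    from mon_mem_genideal_mon[OF gens_carrier that(2)] obtain a b
      where ab: "(a, b) \<in> shape" "pp_dvd (ev a + ev b) (ev i + ev j)"
      by (auto simp: gens_def)
    then have "ev a + ev b = ev i + ev j"
      by (intro pp_dvd_tdeg_eq) (auto simp: tdeg_add)
    then show ?thesis using ev_pair_eq[of a b i j] that(1) ab(1) by (auto simp: shape_iff)
  qed
  have shapeD: "(mon (ev i + ev j) :: 'k pol) \<in> genideal (mpoly_ring n) (mon ` gens)" if "(i, j) \<in> shape" for i j
    using genideal_self[OF gens_carrier] that by (force simp: gens_def)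
  have "i \<le> j \<and> (mon (ev i + ev j) :: 'k pol) \<in> genideal (mpoly_ring n) (mon ` gens) \<longleftrightarrow> (i, j) \<in> shape"
    for i j using shapeI shapeD shape_iff by blast
  then show ?thesis by (simp only: X_verts_def ferrers_ideal_eq var_mult_var) simp
qed

lemma X_cells_eq: "X_cells (ferrers_stable_ideal m lam :: 'k::comm_ring_1 pol set) = cells"
  by (simp add: fun_eq_iff X_cells_def cells_def X_verts_eq)

text \<open>
  The exponent two is attained by the generators \<open>x\<^sub>k\<^sup>2\<close>, which exist for \<open>k \<le> m\<close>, and the exponent one by
  \<open>x\<^sub>1 x\<^sub>k\<close>.
\<close>

lemma lookup_L: "Poly_Mapping.lookup L k = (if 1 \<le> k \<and> k \<le> m then 2 else if 1 \<le> k \<and> k \<le> n then 1 else 0)"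
proof -
  let ?S = "insert 0 ((\<lambda>t. Poly_Mapping.lookup t k) ` gens)"
  have fin: "finite ?S" by (simp add: finite_gens)
  have in_S: "Poly_Mapping.lookup (ev i + ev j) k \<in> ?S" if "(i, j) \<in> shape" for i j
    using that by (force simp: gens_def)
  have ub: "x \<le> (if 1 \<le> k \<and> k \<le> m then 2 else if 1 \<le> k \<and> k \<le> n then 1 else 0)" if "x \<in> ?S" for x
    using that shape_le_n by (fastforce simp: gens_def lookup_add lookup_ev shape_iff)
  have "(if 1 \<le> k \<and> k \<le> m then 2 else if 1 \<le> k \<and> k \<le> n then 1 else 0) \<in> ?S"
  proof (cases "1 \<le> k \<and> k \<le> m")
    case True
    then have "(k, k) \<in> shape" using m_le_lam'[of k] by (simp add: shape_iff)
    from in_S[OF this] show ?thesis using True by (simp add: lookup_add lookup_ev numeral_2_eq_2)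
  next
    case False
    note notm = this
    show ?thesis
    proof (cases "1 \<le> k \<and> k \<le> n")
      case True
      then have "(1, k) \<in> shape" using m_pos n_eq by (simp add: shape_iff)
      moreover have "k \<noteq> 1" using notm m_pos by auto
      ultimately show ?thesis using in_S[of 1 k] True notm by (simp add: lookup_add lookup_ev)
    qed (use notm in auto)
  qed
  then have "Max ?S = (if 1 \<le> k \<and> k \<le> m then 2 else if 1 \<le> k \<and> k \<le> n then 1 else 0)"
    using fin ub by (intro Max_eqI) auto
  then show ?thesis by (simp only: L_def lookup_pp_lcm[OF finite_gens])
qed

lemma keys_L: "Poly_Mapping.keys L = {1..n}"
  using m_le_n by (auto simp: in_keys_iff lookup_L split: if_splits)

lemma tdeg_L: "tdeg L = m + n"
proof -
  have "tdeg L = (\<Sum>k\<in>{1..m} \<union> {m + 1..n}. Poly_Mapping.lookup L k)"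
    using m_le_n by (intro tdeg_eq_sum) (auto simp: keys_L)
  also have "\<dots> = (\<Sum>k\<in>{1..m}. Poly_Mapping.lookup L k) + (\<Sum>k\<in>{m + 1..n}. Poly_Mapping.lookup L k)"
    by (intro sum.union_disjoint) auto
  also have "(\<Sum>k\<in>{1..m}. Poly_Mapping.lookup L k) = (\<Sum>k\<in>{1..m}. 2)"
    by (intro sum.cong) (auto simp: lookup_L)
  also have "(\<Sum>k\<in>{m + 1..n}. Poly_Mapping.lookup L k) = (\<Sum>k\<in>{m + 1..n}. 1)"
    by (intro sum.cong) (auto simp: lookup_L)
  finally show ?thesis using m_le_n by simp
qed

lemma pp_dvd_L: "(i, j) \<in> shape \<Longrightarrow> pp_dvd (ev i + ev j) L"
  using shape_le_n[of i j] by (auto simp: pp_dvd_def lookup_add lookup_ev lookup_L shape_iff)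

text \<open>
  The least common multiple of \<open>m\<^sub>I / s\<close> and \<open>m\<^sub>I / t\<close> is \<open>m\<^sub>I\<close> divided by the greatest common divisor of
  \<open>s\<close> and \<open>t\<close>. At the two ends of an edge this divisor is the variable of the shared index; the four
  corners of a square with \<open>i < j\<close> have no variable in common.
\<close>

lemma X_label_eq:
  "X_label L Empty = 0"
  "(i, j) \<in> shape \<Longrightarrow> X_label L (Vert i j) = L - (ev i + ev j)"
  "VEdge i j \<in> cells 2 \<Longrightarrow> X_label L (VEdge i j) = L - ev j"
  "HEdge i j \<in> cells 2 \<Longrightarrow> X_label L (HEdge i j) = L - ev i"
  "Square i j \<in> cells 3 \<Longrightarrow> X_label L (Square i j) = L"
proof -
  note lk = lookup_pp_lcm lookup_minus lookup_add lookup_ev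
  show "X_label L Empty = 0"
    by (rule poly_mapping_eqI) (simp add: X_label_def lookup_pp_lcm)
  show "X_label L (Vert i j) = L - (ev i + ev j)"
    by (rule poly_mapping_eqI) (simp add: X_label_def lookup_pp_lcm)
  show "X_label L (VEdge i j) = L - ev j" if "VEdge i j \<in> cells 2"
    by (rule poly_mapping_eqI) (auto simp: X_label_def lk max_def)
  show "X_label L (HEdge i j) = L - ev i" if "HEdge i j \<in> cells 2"
    by (rule poly_mapping_eqI) (auto simp: X_label_def lk max_def)
  show "X_label L (Square i j) = L" if "Square i j \<in> cells 3"
    using that unfolding Square_cell
    by (intro poly_mapping_eqI) (auto simp: X_label_def lk max_def)
qed

section \<open>The differentials\<close>

abbreviation bd :: "cell \<Rightarrow> cell \<Rightarrow> 'k::field pol" where "bd \<equiv> X_boundary L"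

lemma X_boundary_fun:
  "bd (Vert i j) = unit_vec Empty (mon (L - (ev i + ev j)))"
  "bd (VEdge i j) = (\<lambda>c. unit_vec (Vert i j) (var i) c - unit_vec (Vert (i + 1) j) (var (i + 1)) c)"
  "bd (HEdge i j) = (\<lambda>c. unit_vec (Vert i j) (var j) c - unit_vec (Vert i (j + 1)) (var (j + 1)) c)"
  "bd (Square i j) = (\<lambda>c. ((unit_vec (HEdge i j) (var i) c + unit_vec (VEdge i (j + 1)) (var (j + 1)) c)
     - unit_vec (HEdge (i + 1) j) (var (i + 1)) c) - unit_vec (VEdge i j) (var j) c)"
  by (simp_all add: fun_eq_iff)

lemma shape_in_range: "(i, j) \<in> shape \<Longrightarrow> i \<in> {1..n} \<and> j \<in> {1..n}"
  using shape_le_n[of i j] by (auto simp: shape_iff)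

lemma bd_closed:
  assumes "c \<in> cells (k + 1)"
  shows "(bd c :: cell \<Rightarrow> 'k::field pol) \<in> carrier (free_module (mpoly_ring n) (cells k))"
proof (cases c)
  case (Vert i j)
  have "Poly_Mapping.keys (L - (ev i + ev j)) \<subseteq> Poly_Mapping.keys L"
    by (auto simp: in_keys_iff lookup_minus)
  then show ?thesis
    using assms unfolding Vert X_boundary_fun by (intro free_unit disjI1 conjI) (auto simp: keys_L)
next
  case (VEdge i j)
  then have "VEdge i j \<in> cells (k + 1)" using assms by simp
  then show ?thesis
    unfolding VEdge X_boundary_fun
    by (intro free_diff free_unit disjI1 conjI) (auto simp del: atLeastAtMost_iff dest!: shape_in_range)
next
  case (HEdge i j)
  then have "HEdge i j \<in> cells (k + 1)" using assms by simp
  then show ?thesis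
    unfolding HEdge X_boundary_fun
    by (intro free_diff free_unit disjI1 conjI) (auto simp del: atLeastAtMost_iff dest!: shape_in_range)
next
  case (Square i j)
  then have "Square i j \<in> cells (k + 1)" using assms by simp
  then show ?thesis
    unfolding Square X_boundary_fun
    by (intro free_diff free_add free_unit disjI1 conjI) (auto simp del: atLeastAtMost_iff dest!: shape_in_range)
qed (use assms in simp)

definition twist :: "nat \<Rightarrow> int" where
  "twist = (\<lambda>_. 0)(1 := - int m - int n + 2, 2 := - int m - int n + 1, 3 := - int m - int n)"

lemma pp_dvd_ev_L: "i \<in> {1..n} \<Longrightarrow> pp_dvd (ev i) L"
  by (auto simp: pp_dvd_def lookup_ev lookup_L)

lemma label_degree:
  assumes "c \<in> cells k"
  shows "int (tdeg (X_label L c)) = - twist k"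
proof (cases c)
  case Empty
  then show ?thesis using assms by (simp add: X_label_eq twist_def tdeg_def)
next
  case (Vert i j)
  with assms have "(i, j) \<in> shape" "k = 1" by auto
  then show ?thesis using m_pos m_le_n
    by (simp add: Vert X_label_eq twist_def tdeg_diff pp_dvd_L tdeg_add tdeg_L)
next
  case (VEdge i j)
  with assms have *: "VEdge i j \<in> cells 2" "k = 2" and "(i, j) \<in> shape" by auto
  then have "pp_dvd (ev j) L" using shape_in_range pp_dvd_ev_L by blast
  then show ?thesis using m_pos m_le_n *
    by (simp add: VEdge X_label_eq(3)[OF *(1)] twist_def tdeg_diff tdeg_L del: cells_iff)
next
  case (HEdge i j)
  with assms have *: "HEdge i j \<in> cells 2" "k = 2" and "(i, j) \<in> shape" by auto
  then have "pp_dvd (ev i) L" using shape_in_range pp_dvd_ev_L by blast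
  then show ?thesis using m_pos m_le_n *
    by (simp add: HEdge X_label_eq(4)[OF *(1)] twist_def tdeg_diff tdeg_L del: cells_iff)
next
  case (Square i j)
  with assms have *: "Square i j \<in> cells 3" "k = 3" by auto
  then show ?thesis
    by (simp add: Square X_label_eq(5)[OF *(1)] twist_def tdeg_L del: cells_iff)
qed

lemma facet_quotient:
  assumes "(i, j) \<in> shape"
  shows "(L - ev j) - (L - (ev i + ev j)) = ev i" "(L - ev i) - (L - (ev i + ev j)) = ev j"
    "L - (L - ev i) = ev i" "L - (L - ev j) = ev j"
proof -
  have ij: "pp_dvd (ev i + ev j) L" by (rule pp_dvd_L[OF assms])
  show "(L - ev j) - (L - (ev i + ev j)) = ev i" by (rule pp_diff_diff[OF ij])
  show "(L - ev i) - (L - (ev i + ev j)) = ev j" using pp_diff_diff[of "ev j" "ev i" L] ij by (simp add: add.commute)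
  show "L - (L - ev i) = ev i" using pp_diff_diff[of "ev i" 0 L] pp_dvd_ev_L shape_in_range assms by simp
  show "L - (L - ev j) = ev j" using pp_diff_diff[of "ev j" 0 L] pp_dvd_ev_L shape_in_range assms by simp
qed

lemma facet_dvd:
  "pp_dvd (L - (ev i + ev j)) (L - ev i)" "pp_dvd (L - (ev i + ev j)) (L - ev j)" "pp_dvd (L - ev i) L"
  by (simp_all add: pp_dvd_def lookup_minus lookup_add diff_le_mono2)

lemma cellular: "cellular_supported cells cell_verts (X_label L) twist (bd :: cell \<Rightarrow> cell \<Rightarrow> 'k::field pol)"
  unfolding cellular_supported_def
proof (intro conjI allI ballI)
  fix k c c' assume c: "c \<in> cells (k + 1)" and c': "c' \<in> cells k"
  show "if cell_verts c' \<subseteq> cell_verts c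
    then pp_dvd (X_label L c') (X_label L c) \<and>
      ((bd c c' :: 'k pol) = mon (X_label L c - X_label L c') \<or> (bd c c' :: 'k pol) = - mon (X_label L c - X_label L c'))
    else (bd c c' :: 'k pol) = 0"
  proof (cases c)
    case Empty
    then show ?thesis using c by simp
  next
    case (Vert i j)
    then have "k = 0" "(i, j) \<in> shape" using c by auto
    moreover then have "c' = Empty" using c' by (simp add: cells_0)
    ultimately show ?thesis
      by (simp add: Vert X_label_eq unit_vec_def pp_dvd_def)
  next
    case (VEdge i j)
    then have k: "k = 1" and cell: "VEdge i j \<in> cells 2" and s: "(i, j) \<in> shape" "(i + 1, j) \<in> shape"
      using c by auto
    then obtain p q where V: "c' = Vert p q" "(p, q) \<in> shape" using c' by (cases c') auto
    show ?thesis
      unfolding VEdge V X_label_eq(2)[OF V(2)] X_label_eq(3)[OF cell]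
      using facet_quotient[OF s(1)] facet_quotient[OF s(2)] facet_dvd
      by (auto simp: unit_vec_def var_def)
  next
    case (HEdge i j)
    then have k: "k = 1" and cell: "HEdge i j \<in> cells 2" and s: "(i, j) \<in> shape" "(i, j + 1) \<in> shape"
      using c by auto
    then obtain p q where V: "c' = Vert p q" "(p, q) \<in> shape" using c' by (cases c') auto
    show ?thesis
      unfolding HEdge V X_label_eq(2)[OF V(2)] X_label_eq(4)[OF cell]
      using facet_quotient[OF s(1)] facet_quotient[OF s(2)] facet_dvd
      by (auto simp: unit_vec_def var_def)
  next
    case (Square i j)
    then have k: "k = 2" and cell: "Square i j \<in> cells 3" and s: "(i, j) \<in> shape" "(i + 1, j + 1) \<in> shape"
      using c by auto
    from c' k consider p q where "c' = VEdge p q" "VEdge p q \<in> cells 2" | p q where "c' = HEdge p q" "HEdge p q \<in> cells 2"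
      by (cases c') auto
    then show ?thesis
    proof cases
      case (1 p q)
      show ?thesis
        unfolding Square 1(1) X_label_eq(3)[OF 1(2)] X_label_eq(5)[OF cell]
        using facet_quotient[OF s(1)] facet_quotient[OF s(2)] facet_dvd
        by (auto simp: unit_vec_def var_def)
    next
      case (2 p q)
      show ?thesis
        unfolding Square 2(1) X_label_eq(4)[OF 2(2)] X_label_eq(5)[OF cell]
        using facet_quotient[OF s(1)] facet_quotient[OF s(2)] facet_dvd
        by (auto simp: unit_vec_def var_def)
    qed
  qed
qed (rule label_degree)

abbreviation F :: "nat \<Rightarrow> (cell \<Rightarrow> 'k::field pol) set" where
  "F k \<equiv> carrier (free_module (mpoly_ring n) (cells k))"

definition d :: "nat \<Rightarrow> (cell \<Rightarrow> 'k::field pol) \<Rightarrow> cell \<Rightarrow> 'k pol" where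
  "d k = lin_ext (cells (k + 1)) bd"

lemma d_closed: "u \<in> F (k + 1) \<Longrightarrow> d k u \<in> F k"
  unfolding d_def by (rule lin_ext_closed[OF bd_closed])

lemma d_explicit:
  "d 0 = lin_ext (cells 1) bd" "d 1 = lin_ext (cells 2) bd" "d 2 = lin_ext (cells 3) bd"
  by (simp_all add: d_def numeral_2_eq_2 numeral_3_eq_3)

lemma d1_closed: "u \<in> F 2 \<Longrightarrow> d 1 u \<in> F 1"
  and d2_closed: "v \<in> F 3 \<Longrightarrow> d 2 v \<in> F 2"
  using d_closed[of u 1] d_closed[of v 2] by (simp_all add: numeral_2_eq_2 numeral_3_eq_3)

lemma F_zero: "u \<in> F k \<Longrightarrow> c \<notin> cells k \<Longrightarrow> u c = 0"
  by (simp add: free_carrier)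

lemma d_add: "d k (\<lambda>c. u c + v c) = (\<lambda>c. d k u c + d k v c)"
  and d_diff: "d k (\<lambda>c. u c - v c) = (\<lambda>c. d k u c - d k v c)"
  by (simp_all add: d_def lin_ext_add lin_ext_diff)

lemma d_unit:
  "e \<in> cells (k + 1) \<or> p = 0 \<Longrightarrow> d k (unit_vec e p) = (\<lambda>c. p * bd e c)"
  unfolding d_def by (rule lin_ext_unit[OF finite_cells])

lemma d_zero: "d k (\<lambda>c. 0) = (\<lambda>c. 0 :: 'k::field pol)"
  by (simp add: d_def lin_ext_def)

text \<open>
  Coordinates at edges and squares outside the complex are zero, so the three formulas that follow are
  also valid where some of the neighbouring cells are missing.
\<close>

lemma d1_Vert:
  assumes u: "u \<in> F 2" and ij: "1 \<le> i" "1 \<le> j"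
  shows "d 1 u (Vert i j) = var i * (u (VEdge i j) - u (VEdge (i - 1) j)) + var j * (u (HEdge i j) - u (HEdge i (j - 1)))"
proof -
  let ?E = "{VEdge i j, VEdge (i - 1) j, HEdge i j, HEdge i (j - 1)}"
  have "d 1 u (Vert i j) = (\<Sum>c\<in>?E. u c * bd c (Vert i j))"
    unfolding d_explicit
  proof (rule lin_ext_coord)
    show "bd c (Vert i j) = 0" if "c \<in> cells 2" "c \<notin> ?E" for c
      using that by (cases c) (auto simp: unit_vec_def)
  qed (use u F_zero in \<open>auto simp: finite_cells\<close>)
  then show ?thesis using ij by (cases i; cases j) (simp_all add: unit_vec_def algebra_simps)
qed

lemma d2_VEdge:
  assumes u: "u \<in> F 3" and j: "1 \<le> j"
  shows "d 2 u (VEdge i j) = var j * (u (Square i (j - 1)) - u (Square i j))"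
proof -
  let ?E = "{Square i (j - 1), Square i j}"
  have "d 2 u (VEdge i j) = (\<Sum>c\<in>?E. u c * bd c (VEdge i j))"
    unfolding d_explicit
  proof (rule lin_ext_coord)
    show "bd c (VEdge i j) = 0" if "c \<in> cells 3" "c \<notin> ?E" for c
      using that by (cases c) (auto simp: unit_vec_def)
  qed (use u F_zero in \<open>auto simp: finite_cells\<close>)
  then show ?thesis using j by (cases j) (simp_all add: unit_vec_def algebra_simps)
qed

lemma d2_HEdge:
  assumes u: "u \<in> F 3" and i: "1 \<le> i"
  shows "d 2 u (HEdge i j) = var i * (u (Square i j) - u (Square (i - 1) j))"
proof -
  let ?E = "{Square (i - 1) j, Square i j}"
  have "d 2 u (HEdge i j) = (\<Sum>c\<in>?E. u c * bd c (HEdge i j))"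
    unfolding d_explicit
  proof (rule lin_ext_coord)
    show "bd c (HEdge i j) = 0" if "c \<in> cells 3" "c \<notin> ?E" for c
      using that by (cases c) (auto simp: unit_vec_def)
  qed (use u F_zero in \<open>auto simp: finite_cells\<close>)
  then show ?thesis using i by (cases i) (simp_all add: unit_vec_def algebra_simps)
qed

lemma d1_d2:
  assumes u: "(u :: cell \<Rightarrow> 'k::field pol) \<in> F 3"
  shows "d 1 (d 2 u) = (\<lambda>c. 0)"
proof
  fix c
  note v = d2_closed[OF u]
  note w = d1_closed[OF v]
  show "d 1 (d 2 u) c = 0"
  proof (cases "c \<in> cells 1")
    case True
    then obtain i j where c: "c = Vert i j" "1 \<le> i" "1 \<le> j" by (cases c) (auto simp: shape_iff)
    show ?thesis
      unfolding c(1) d1_Vert[OF v c(2,3)] d2_VEdge[OF u c(3)] d2_HEdge[OF u c(2)]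
      by (simp add: algebra_simps)
  qed (use F_zero[OF w] in blast)
qed

text \<open>
  Both ends of an edge contribute the label of the edge, with opposite signs.
\<close>

lemma d0_edge:
  assumes c: "c \<in> cells 2"
  shows "d 0 (bd c :: cell \<Rightarrow> 'k::field pol) = (\<lambda>c. 0)"
proof -
  have add: "ev i + (L - (ev i + ev j)) = L - ev j" "ev j + (L - (ev i + ev j)) = L - ev i"
    if "(i, j) \<in> shape" for i j
  proof -
    have *: "Poly_Mapping.lookup (ev i) k + Poly_Mapping.lookup (ev j) k \<le> Poly_Mapping.lookup L k" for k
      using pp_dvd_L[OF that] by (simp add: pp_dvd_def lookup_add)
    show "ev i + (L - (ev i + ev j)) = L - ev j"
      by (rule poly_mapping_eqI) (use * in \<open>simp add: lookup_add lookup_minus le_diff_conv2 add.commute\<close>)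
    show "ev j + (L - (ev i + ev j)) = L - ev i"
      by (rule poly_mapping_eqI) (use * in \<open>simp add: lookup_add lookup_minus le_diff_conv2 add.commute\<close>)
  qed
  have unit: "lin_ext (cells 1) bd (unit_vec (Vert i j) p) = (\<lambda>c'. p * bd (Vert i j) c' :: 'k pol)"
    if "(i, j) \<in> shape" for i j and p :: "'k pol"
    using that by (intro lin_ext_unit) (auto simp: finite_cells)
  from c show ?thesis
  proof (cases c)
    case (VEdge i j)
    then have s: "(i, j) \<in> shape" "(i + 1, j) \<in> shape" using c by auto
    show ?thesis
      unfolding d_explicit VEdge X_boundary_fun lin_ext_diff unit[OF s(1)] unit[OF s(2)]
      using add[OF s(1)] add[OF s(2)] by (simp add: fun_eq_iff unit_vec_def var_mult_mon)
  next
    case (HEdge i j)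
    then have s: "(i, j) \<in> shape" "(i, j + 1) \<in> shape" using c by auto
    show ?thesis
      unfolding d_explicit HEdge X_boundary_fun lin_ext_diff unit[OF s(1)] unit[OF s(2)]
      using add[OF s(1)] add[OF s(2)] by (simp add: fun_eq_iff unit_vec_def var_mult_mon)
  qed auto
qed

lemma d0_d1: "d 0 (d 1 (u :: cell \<Rightarrow> 'k::field pol)) = (\<lambda>c. 0)"
  unfolding d_explicit lin_ext_lin_ext
  by (subst lin_ext_def) (intro ext sum.neutral ballI, simp only: d0_edge[unfolded d_explicit] mult_zero_right)

section \<open>Exactness at the squares and at the edges\<close>

text \<open>
  The coordinate of the boundary at \<open>HEdge (i + 1) j\<close> compares the squares \<open>Square i j\<close> and
  \<open>Square (i + 1) j\<close>, and there are no squares in row \<open>0\<close>.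
\<close>

lemma d2_injective:
  assumes u: "(u :: cell \<Rightarrow> 'k::field pol) \<in> F 3" and ker: "d 2 u = (\<lambda>c. 0)"
  shows "u = (\<lambda>c. 0)"
proof -
  have "u (Square i j) = 0" for i j
  proof (induction i)
    case 0
    then show ?case by (rule F_zero[OF u]) (simp add: shape_iff)
  next
    case (Suc i)
    have "var (Suc i) * (u (Square (Suc i) j) - u (Square i j)) = 0"
      using d2_HEdge[OF u, of "Suc i" j] ker by simp
    then show ?case using Suc by simp
  qed
  moreover have "u c = 0" if "\<And>i j. c \<noteq> Square i j" for c
    by (rule F_zero[OF u]) (use that in \<open>cases c; simp\<close>)
  ultimately show ?thesis by (metis ext)
qed

text \<open>
  Let \<open>a\<close> and \<open>b\<close> be the coordinates at vertical and horizontal edges. The equation at the vertex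
  \<open>(i, j)\<close> reads \<open>x\<^sub>i (a i j - a (i - 1) j) = x\<^sub>j (b i (j - 1) - b i j)\<close>, and for \<open>i < j\<close> both sides are
  \<open>x\<^sub>i x\<^sub>j c i j\<close> for some polynomial \<open>c i j\<close>. Since \<open>a\<close> vanishes above the first row and \<open>b\<close> beyond the
  end of a row, \<open>a i j\<close> is \<open>x\<^sub>j\<close> times the sum of \<open>c\<close> over the column segment ending at \<open>(i, j)\<close>, and
  \<open>b i j\<close> is \<open>x\<^sub>i\<close> times the sum of \<open>c\<close> over the part of row \<open>i\<close> to the right of \<open>j\<close>. The sums of \<open>c\<close> over
  the quadrants \<open>i' \<le> i\<close>, \<open>j < j'\<close> have exactly these segments as their differences, so they are
  the coordinates of the desired chain of squares. It remains to see that they vanish where the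
  complex has no square. On the diagonal this comes from the vertex equations at \<open>(i, i)\<close>, which have
  not entered the definition of \<open>c\<close>; elsewhere the row below is too short or missing, so there are no vertical
  edges in the columns \<open>j' > j\<close> and all their column sums vanish.
\<close>

lemma ker_d1:
  assumes u: "(u :: cell \<Rightarrow> 'k::field pol) \<in> F 2" and ker: "d 1 u = (\<lambda>c. 0)"
  obtains w where "w \<in> F 3" "u = d 2 w"
proof -
  let ?a = "\<lambda>i j. u (VEdge i j)"
  let ?b = "\<lambda>i j. u (HEdge i j)"
  have a0: "?a i j = 0" if "i = 0 \<or> (i + 1, j) \<notin> shape" for i j
    using that by (intro F_zero[OF u]) (auto simp: shape_iff)
  have b0: "?b i j = 0" if "j < i \<or> (i, j + 1) \<notin> shape" for i j
    using that by (intro F_zero[OF u]) (auto simp: shape_iff)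
  have vertex: "var i * (?a i j - ?a (i - 1) j) + var j * (?b i j - ?b i (j - 1)) = 0"
    if "1 \<le> i" "1 \<le> j" for i j
    using d1_Vert[OF u that] ker by simp
  have "\<exists>c. c \<in> carrier (mpoly_ring n) \<and> (1 \<le> i \<and> i < j \<longrightarrow>
      ?a i j - ?a (i - 1) j = var j * c \<and> ?b i (j - 1) - ?b i j = var i * c)" for i j
  proof (cases "1 \<le> i \<and> i < j")
    case True
    then have ij: "1 \<le> i" "1 \<le> j" "i \<noteq> j" by auto
    have eq: "var i * (?a i j - ?a (i - 1) j) = var j * (?b i (j - 1) - ?b i j)"
      using vertex[OF ij(1,2)] by (simp add: algebra_simps)
    have "?a i j - ?a (i - 1) j \<in> carrier (mpoly_ring n)"
      by (intro mpoly_diff free_coord[OF u])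
    from var_cross_multiple[OF ij(3) this eq] show ?thesis by metis
  qed (use mpoly_zero in blast)
  then obtain c where c_closed: "\<And>i j. c i j \<in> carrier (mpoly_ring n)"
    and ca: "\<And>i j. 1 \<le> i \<Longrightarrow> i < j \<Longrightarrow> ?a i j - ?a (i - 1) j = var j * c i j"
    and cb: "\<And>i j. 1 \<le> i \<Longrightarrow> i < j \<Longrightarrow> ?b i (j - 1) - ?b i j = var i * c i j"
    by metis
  define C where "C i j = (\<Sum>i'\<in>{1..i}. c i' j)" for i j
  define D where "D i j = (\<Sum>j'\<in>{j + 1..n}. c i j')" for i j
  \<comment> \<open>The sum of \<open>c\<close> over the quadrant above and to the right of the square.\<close>
  define p where "p i j = (\<Sum>i'\<in>{1..i}. D i' j)" for i j
  have a_C: "i < j \<Longrightarrow> ?a i j = var j * C i j" for i j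
  proof (induction i)
    case 0
    then show ?case using a0[of 0 j] by (simp add: C_def)
  next
    case (Suc i)
    then have "?a (Suc i) j = ?a i j + var j * c (Suc i) j"
      using ca[of "Suc i" j] by (simp add: algebra_simps)
    also have "\<dots> = var j * C (Suc i) j"
      using Suc by (simp add: C_def algebra_simps)
    finally show ?case .
  qed
  have out: "C i j = 0" if "n < j" "i < j" for i j
  proof -
    have "(i + 1, j) \<notin> shape" using that shape_le_n[of "i + 1" j] by auto
    then show ?thesis using a_C[OF that(2)] a0[of i j] by simp
  qed
  have b_D: "1 \<le> i \<Longrightarrow> i \<le> j \<Longrightarrow> ?b i j = var i * D i j" for i j
  proof (induction "n - j" arbitrary: j)
    case 0
    then have "(i, j + 1) \<notin> shape" using shape_le_n[of i "j + 1"] by auto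
    then show ?case using 0 b0[of j i] by (simp add: D_def)
  next
    case (Suc k)
    then have "?b i j = ?b i (j + 1) + var i * c i (j + 1)"
      using cb[of i "j + 1"] by (simp add: algebra_simps)
    moreover have "{j + 1..n} = insert (j + 1) {(j + 1) + 1..n}" using Suc(2) by auto
    ultimately show ?case using Suc by (simp add: D_def algebra_simps)
  qed
  have p_row: "p i j - p (i - 1) j = D i j" if "1 \<le> i" for i j
    using that by (cases i) (simp_all add: p_def)
  have p_swap: "p i j = (\<Sum>j'\<in>{j + 1..n}. C i j')" for i j
    unfolding p_def D_def C_def by (rule sum.swap)
  have p_col: "p i j - p i (j + 1) = C i (j + 1)" if "i < j + 1" for i j
  proof (cases "j + 1 \<le> n")
    case True
    then have "{j + 1..n} = insert (j + 1) {(j + 1) + 1..n}" by auto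
    then show ?thesis unfolding p_swap by simp
  next
    case False
    then show ?thesis unfolding p_swap using out[of "j + 1" i] that by simp
  qed
  \<comment> \<open>The vertex \<open>(i, i)\<close> has one edge above it and one to its right; their coordinates agree.\<close>
  have diag: "p i i = 0" for i
  proof (induction i)
    case 0 show ?case by (simp add: p_def)
  next
    case (Suc i)
    have "?a (Suc i) (Suc i) = 0" "?b (Suc i) i = 0"
      by (rule a0, simp add: shape_iff) (rule b0, simp)
    then have "var (Suc i) * (D (Suc i) (Suc i) - C i (Suc i)) * var (Suc i) = 0"
      using vertex[of "Suc i" "Suc i"] a_C[of i "Suc i"] b_D[of "Suc i" "Suc i"]
      by (simp add: algebra_simps)
    then have "D (Suc i) (Suc i) = C i (Suc i)" by simp
    then have "p (Suc i) (Suc i) - p i (Suc i) = p i i - p i (Suc i)"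
      using p_row[of "Suc i" "Suc i"] p_col[of i i] by simp
    then show ?case using Suc by simp
  qed
  \<comment> \<open>No square at \<open>(i, j)\<close> means that row \<open>i + 1\<close> does not reach column \<open>j + 1\<close>.\<close>
  have p_zero: "p i j = 0" if ij: "i \<le> j" and not_cell: "Square i j \<notin> cells 3" for i j
  proof (cases "i = 0 \<or> i = j")
    case True
    then show ?thesis using diag by (auto simp: p_def)
  next
    case False
    then have corner: "(i + 1, j + 1) \<notin> shape" using not_cell ij unfolding Square_cell by auto
    have "C i j' = 0" if "j' \<in> {j + 1..n}" for j'
    proof -
      have "(i + 1, j') \<notin> shape" using corner that ij False by (auto simp: shape_iff)
      then show ?thesis using a_C[of i j'] a0[of i j'] that ij by simp
    qed
    then show ?thesis unfolding p_swap by simp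
  qed
  define w :: "cell \<Rightarrow> 'k pol" where
    "w s = (if s \<in> cells 3 then case s of Square i j \<Rightarrow> p i j | _ \<Rightarrow> 0 else 0)" for s
  have p_closed: "p i j \<in> carrier (mpoly_ring n)" for i j
    unfolding p_def D_def by (intro mpoly_sum c_closed)
  have w: "w \<in> F 3"
    by (auto simp: free_carrier w_def p_closed mpoly_zero split: cell.split)
  have w_eq: "w (Square i j) = p i j" if "i \<le> j" for i j
    using p_zero[OF that] by (auto simp: w_def)
  have "u e = d 2 w e" for e
  proof (cases "e \<in> cells 2")
    case True
    then consider i j where "e = VEdge i j" "1 \<le> i" "i + 1 \<le> j" | i j where "e = HEdge i j" "1 \<le> i" "i \<le> j"
      by (cases e) (auto simp: shape_iff)
    then show ?thesis
    proof cases
      case (1 i j)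
      have "d 2 w e = var j * (p i (j - 1) - p i j)"
        using 1 by (simp add: d2_VEdge[OF w] w_eq)
      also have "\<dots> = ?a i j" using 1 p_col[of i "j - 1"] a_C[of i j] by simp
      finally show ?thesis using 1 by simp
    next
      case (2 i j)
      have "d 2 w e = var i * (p i j - p (i - 1) j)"
        using 2 by (simp add: d2_HEdge[OF w] w_eq)
      also have "\<dots> = ?b i j" using 2 p_row[of i j] b_D[of i j] by simp
      finally show ?thesis using 2 by simp
    qed
  next
    case False
    then show ?thesis using F_zero[OF u] F_zero[OF d2_closed[OF w]] by simp
  qed
  then show ?thesis using w that by blast
qed

section \<open>Linear quotients and exactness at the vertices\<close>

text \<open>
  The divisibility says that \<open>x\<^sub>i x\<^sub>j\<close> divides \<open>t x\<^sub>a x\<^sub>b\<close>. As \<open>(a, b)\<close> differs from \<open>(i, j)\<close>, it cannot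
  supply both variables, and \<open>t\<close> has to supply a missing one: \<open>x\<^sub>j\<close> in the first row, where \<open>a = i\<close>,
  and \<open>x\<^sub>i\<close> on the diagonal, where \<open>x\<^sub>i\<^sup>2\<close> is needed.
\<close>

lemma colon_variable:
  assumes ij: "(i, j) \<in> shape" and ab: "(a, b) \<in> shape" and before: "a < i \<or> a = i \<and> b < j"
    and dvd: "pp_dvd (L - (ev a + ev b)) (t + (L - (ev i + ev j)))"
  shows "i < j \<Longrightarrow> 0 < Poly_Mapping.lookup t i \<or> 0 < Poly_Mapping.lookup t j"
    and "i = 1 \<Longrightarrow> 0 < Poly_Mapping.lookup t j" "i = j \<Longrightarrow> 0 < Poly_Mapping.lookup t i"
proof -
  have key: "Poly_Mapping.lookup (ev i + ev j) k \<le> Poly_Mapping.lookup t k + Poly_Mapping.lookup (ev a + ev b) k" for k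
  proof -
    have "Poly_Mapping.lookup L k - Poly_Mapping.lookup (ev a + ev b) k \<le>
        Poly_Mapping.lookup t k + (Poly_Mapping.lookup L k - Poly_Mapping.lookup (ev i + ev j) k)"
      using dvd unfolding pp_dvd_def lookup_add[of t] lookup_minus by blast
    moreover have "Poly_Mapping.lookup (ev i + ev j) k \<le> Poly_Mapping.lookup L k"
      "Poly_Mapping.lookup (ev a + ev b) k \<le> Poly_Mapping.lookup L k"
      using pp_dvd_L[OF ij] pp_dvd_L[OF ab] by (simp_all add: pp_dvd_def)
    ultimately show ?thesis by linarith
  qed
  have ord: "1 \<le> i" "i \<le> j" "1 \<le> a" "a \<le> b" using ij ab by (auto simp: shape_iff)
  have ki: "(if i = j then 2 else 1) \<le> Poly_Mapping.lookup t i + (if i = a then 1 else 0) + (if i = b then 1 else 0)"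
    using key[of i] by (auto simp: lookup_add lookup_ev split: if_splits)
  have kj: "(if i = j then 2 else 1) \<le> Poly_Mapping.lookup t j + (if j = a then 1 else 0) + (if j = b then 1 else 0)"
    using key[of j] by (auto simp: lookup_add lookup_ev split: if_splits)
  show "0 < Poly_Mapping.lookup t i \<or> 0 < Poly_Mapping.lookup t j" if "i < j"
    using ki kj ord before that by (cases "i = a"; cases "i = b"; cases "j = a"; cases "j = b") auto
  show "0 < Poly_Mapping.lookup t j" if "i = 1"
    using kj ord before that by (cases "j = a"; cases "j = b") auto
  show "0 < Poly_Mapping.lookup t i" if "i = j"
    using ki ord before that by (cases "i = a"; cases "i = b") auto
qed

lemma d0_Empty: "d 0 u Empty = (\<Sum>c\<in>cells 1. u c * bd c Empty)"
  by (simp add: d_explicit lin_ext_def)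

lemma cells_1: "c \<in> cells (Suc 0) \<longleftrightarrow> (\<exists>i j. c = Vert i j \<and> (i, j) \<in> shape)"
  by (cases c) auto

definition before :: "nat \<Rightarrow> nat \<Rightarrow> cell set" where
  "before i j = {c. \<exists>a b. c = Vert a b \<and> (a < i \<or> a = i \<and> b < j)}"

text \<open>
  In a syzygy a term of the last coordinate, multiplied with the label of \<open>(i, j)\<close>, cancels against
  a multiple of an earlier label. So \<open>x\<^sub>i\<close> or \<open>x\<^sub>j\<close> divides it. The variable \<open>x\<^sub>i\<close> is avoided in the
  first row and \<open>x\<^sub>j\<close> on the diagonal, where the upper and the left neighbour, respectively, are missing.
\<close>

lemma last_coefficient:
  assumes u: "(u :: cell \<Rightarrow> 'k::field pol) \<in> F 1" and ker: "d 0 u = (\<lambda>c. 0)"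
    and supp: "\<And>c. u c \<noteq> 0 \<Longrightarrow> c \<in> before i (j + 1)" and ij: "(i, j) \<in> shape"
  obtains q r where "q \<in> carrier (mpoly_ring n)" "r \<in> carrier (mpoly_ring n)"
    "u (Vert i j) = var i * q + var j * r" "i = 1 \<longrightarrow> q = 0" "i = j \<longrightarrow> r = 0"
proof -
  let ?T = "\<lambda>i j. L - (ev i + ev j)"
  have "\<exists>a b. (a, b) \<in> shape \<and> (a < i \<or> a = i \<and> b < j) \<and> pp_dvd (?T a b) (t + ?T i j)"
    if t: "t \<in> Poly_Mapping.keys (u (Vert i j))" for t
  proof -
    let ?s = "\<lambda>c. Poly_Mapping.lookup (u c * bd c Empty) (t + ?T i j)"
    have "sum ?s (cells 1) = Poly_Mapping.lookup (d 0 u Empty) (t + ?T i j)"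
      by (simp only: d0_Empty lookup_sum)
    then have "sum ?s (cells 1) = 0" using ker by simp
    moreover have V: "Vert i j \<in> cells 1" using ij by simp
    moreover have "?s (Vert i j) \<noteq> 0" using t by (simp add: unit_vec_def lookup_mon_mult in_keys_iff)
    ultimately have "sum ?s (cells 1 - {Vert i j}) \<noteq> 0"
      using sum.remove[OF finite_cells V, of ?s] by auto
    then obtain c where c: "c \<in> cells 1" "c \<noteq> Vert i j" "?s c \<noteq> 0"
      by (blast elim: sum.not_neutral_contains_not_neutral)
    then obtain a b where ab: "c = Vert a b" "(a, b) \<in> shape" by (auto simp: cells_1)
    have "u c \<noteq> 0" using c(3) by auto
    then have "a < i \<or> a = i \<and> b < j" using supp[of c] c(2) ab by (auto simp: before_def)
    moreover have "pp_dvd (?T a b) (t + ?T i j)"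
      using c(3) unfolding ab(1) by (intro key_mult_mon[of _ "u (Vert a b)"]) (simp add: unit_vec_def in_keys_iff)
    ultimately show ?thesis using ab(2) by blast
  qed
  note colon = this colon_variable[OF ij]
  have uc: "u (Vert i j) \<in> carrier (mpoly_ring n)" by (rule free_coord[OF u])
  have le: "i \<le> j" using ij by (simp add: shape_iff)
  have "1 \<le> i" using ij by (simp add: shape_iff)
  with le consider "i = 1" "i = j" | "i = 1" "i < j" | "1 < i" "i = j" | "1 < i" "i < j"
    by linarith
  then show ?thesis
  proof cases
    case 1
    have "Poly_Mapping.keys (u (Vert i j)) = {}"
    proof (rule ccontr)
      assume "Poly_Mapping.keys (u (Vert i j)) \<noteq> {}"
      then obtain a b where "(a, b) \<in> shape" "a < i \<or> a = i \<and> b < j" using colon(1) by blast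
      then show False using 1 by (auto simp: shape_iff)
    qed
    then have "u (Vert i j) = 0" by (metis sum_monomials sum.empty)
    then show ?thesis using that[of 0 0] by (simp add: mpoly_zero)
  next
    case 2
    have "0 < Poly_Mapping.lookup t j" if "t \<in> Poly_Mapping.keys (u (Vert i j))" for t
      using colon(1)[OF that] colon(3) 2 by blast
    then obtain q r where "q \<in> carrier (mpoly_ring n)" "u (Vert i j) = var j * q + var j * r" "r = 0"
      using split_two_variables[OF uc, of j j] by metis
    then show ?thesis using that[of 0 q] 2 by (simp add: mpoly_zero)
  next
    case 3
    have "0 < Poly_Mapping.lookup t i" if "t \<in> Poly_Mapping.keys (u (Vert i j))" for t
      using colon(1)[OF that] colon(4) 3 by blast
    then obtain q r where "q \<in> carrier (mpoly_ring n)" "u (Vert i j) = var i * q + var i * r" "r = 0"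
      using split_two_variables[OF uc, of i i] by metis
    then show ?thesis using that[of q 0] 3 by (simp add: mpoly_zero)
  next
    case 4
    have "0 < Poly_Mapping.lookup t i \<or> 0 < Poly_Mapping.lookup t j"
      if "t \<in> Poly_Mapping.keys (u (Vert i j))" for t
      using colon(1)[OF that] colon(2) 4(2) by metis
    then obtain q r where "q \<in> carrier (mpoly_ring n)" "r \<in> carrier (mpoly_ring n)"
      "u (Vert i j) = var i * q + var j * r"
      using split_two_variables[OF uc, of i j] by metis
    then show ?thesis using that 4 by simp
  qed
qed

text \<open>
  The boundaries of the edges to the upper and to the left neighbour have coefficient \<open>-x\<^sub>i\<close> and \<open>-x\<^sub>j\<close> at
  \<open>(i, j)\<close>, and their other ends come earlier in the reading order.
\<close>

lemma remove_last_vertex: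
  assumes u: "(u :: cell \<Rightarrow> 'k::field pol) \<in> F 1" and ker: "d 0 u = (\<lambda>c. 0)"
    and supp: "\<And>c. u c \<noteq> 0 \<Longrightarrow> c \<in> before i (j + 1)"
  obtains v where "v \<in> F 2" "\<And>c. u c + d 1 v c \<noteq> 0 \<Longrightarrow> c \<in> before i j"
proof (cases "(i, j) \<in> shape")
  case False
  then have "u (Vert i j) = 0" by (intro F_zero[OF u]) simp
  then have "c \<in> before i j" if "u c \<noteq> 0" for c
    using supp[OF that] that by (auto simp: before_def less_Suc_eq)
  moreover have "(\<lambda>c. 0 :: 'k pol) \<in> F 2" by (simp add: free_carrier mpoly_zero)
  moreover have "d 1 (\<lambda>c. 0 :: 'k pol) = (\<lambda>c. 0)" by (rule d_zero)
  ultimately show ?thesis using that by (metis add.right_neutral)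
next
  case True
  obtain q r where qr: "q \<in> carrier (mpoly_ring n)" "r \<in> carrier (mpoly_ring n)"
    "u (Vert i j) = var i * q + var j * r" "i = 1 \<longrightarrow> q = 0" "i = j \<longrightarrow> r = 0"
    by (rule last_coefficient[OF u ker supp True])
  let ?V = "VEdge (i - 1) j" and ?H = "HEdge i (j - 1)"
  have ij: "1 \<le> i" "1 \<le> j" "i \<le> j" using True by (auto simp: shape_iff)
  have V: "?V \<in> cells 2 \<or> q = 0" using True qr(4) ij shape_up[of "i - 1" j] by (cases "i = 1") auto
  have H: "?H \<in> cells 2 \<or> r = 0" using True qr(5) ij shape_left[of i "j - 1"] by (cases "i = j") auto
  define v where "v = (\<lambda>c. unit_vec ?V q c + unit_vec ?H r c)"
  have "v \<in> F 2" unfolding v_def using V H qr by (intro free_add free_unit) auto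
  moreover have "c \<in> before i j" if c: "u c + d 1 v c \<noteq> 0" for c
  proof -
    have dv: "d 1 v c = q * bd ?V c + r * bd ?H c"
      unfolding v_def d_add using d_unit[of ?V 1 q] d_unit[of ?H 1 r] V H
      by (simp add: numeral_2_eq_2)
    have "u (Vert i j) + d 1 v (Vert i j) = 0"
      unfolding v_def d_add using d_unit[of ?V 1 q] d_unit[of ?H 1 r] V H ij qr(3)
      by (cases i; cases j) (simp_all add: numeral_2_eq_2 unit_vec_def algebra_simps)
    then have "c \<noteq> Vert i j" using c by auto
    moreover have "c \<in> before i (j + 1)"
    proof (cases "u c = 0")
      case True
      then have "bd ?V c \<noteq> (0 :: 'k pol) \<or> bd ?H c \<noteq> (0 :: 'k pol)" using c dv by auto
      then have "c \<in> {Vert (i - 1) j, Vert i j, Vert i (j - 1)}"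
        using ij by (auto simp: unit_vec_def split: if_splits)
      then show ?thesis using ij by (auto simp: before_def)
    qed (rule supp)
    ultimately show ?thesis by (auto simp: before_def less_Suc_eq)
  qed
  ultimately show ?thesis using that by blast
qed

text \<open>
  Double induction along the rows. The chains supported before the start of row \<open>i + 1\<close> are
  those supported before the position \<open>n + 1\<close> of row \<open>i\<close>, as no column exceeds \<open>n\<close>.
\<close>

lemma ker_d0_before:
  assumes "(u :: cell \<Rightarrow> 'k::field pol) \<in> F 1" "d 0 u = (\<lambda>c. 0)" "\<And>c. u c \<noteq> 0 \<Longrightarrow> c \<in> before i j"
  shows "\<exists>v\<in>F 2. u = d 1 v"
  using assms
proof (induction i arbitrary: u j)
  case zero: 0
  have "u = (\<lambda>c. 0)"
  proof
    fix c
    show "u c = 0"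
    proof (rule ccontr)
      assume nz: "u c \<noteq> 0"
      then have "c \<in> cells 1" using F_zero[OF zero(1)] by blast
      with zero(3)[OF nz] show False by (auto simp: before_def shape_iff)
    qed
  qed
  moreover have "(\<lambda>c. 0 :: 'k pol) \<in> F 2" by (simp add: free_carrier mpoly_zero)
  moreover have "d 1 (\<lambda>c. 0 :: 'k pol) = (\<lambda>c. 0)" by (rule d_zero)
  ultimately show ?case by metis
next
  case (Suc i)
  from Suc.prems show ?case
  proof (induction j arbitrary: u)
    case 0
    have "c \<in> before i (n + 1)" if "u c \<noteq> 0" for c
    proof -
      have "c \<in> cells 1" using that F_zero[OF 0(1)] by blast
      then show ?thesis using 0(3)[OF that] shape_le_n by (fastforce simp: before_def cells_1)
    qed
    then show ?case using Suc.IH[OF 0(1,2)] by blast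
  next
    case (Suc j)
    have supp: "\<And>c. u c \<noteq> 0 \<Longrightarrow> c \<in> before (Suc i) (j + 1)" using Suc.prems(3) by simp
    obtain v where v: "v \<in> F 2" "\<And>c. u c + d 1 v c \<noteq> 0 \<Longrightarrow> c \<in> before (Suc i) j"
      using remove_last_vertex[OF Suc.prems(1,2) supp] by blast
    have "(\<lambda>c. u c + d 1 v c) \<in> F 1"
      by (rule free_add[OF Suc.prems(1) d1_closed[OF v(1)]])
    moreover have "d 0 (\<lambda>c. u c + d 1 v c) = (\<lambda>c. 0)"
      by (simp only: d_add Suc.prems(2) d0_d1) simp
    ultimately obtain w where w: "w \<in> F 2" "(\<lambda>c. u c + d 1 v c) = d 1 w"
      using Suc.IH v(2) by blast
    have "u c = d 1 w c - d 1 v c" for c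
      using fun_cong[OF w(2), of c] by (simp add: algebra_simps)
    then have "u = d 1 (\<lambda>c. w c - v c)" unfolding d_diff by blast
    then show ?case using free_diff[OF w(1) v(1)] by blast
  qed
qed

lemma ker_d0:
  assumes u: "(u :: cell \<Rightarrow> 'k::field pol) \<in> F 1" and "d 0 u = (\<lambda>c. 0)"
  obtains v where "v \<in> F 2" "u = d 1 v"
proof -
  have "c \<in> before (m + 1) 0" if "u c \<noteq> 0" for c
  proof -
    have "c \<in> cells 1" using that F_zero[OF u] by blast
    then show ?thesis by (auto simp: before_def cells_1 shape_iff)
  qed
  from ker_d0_before[OF assms this] that show ?thesis by blast
qed

section \<open>The resolution\<close>

abbreviation dual :: "'k::field pol set" where
  "dual \<equiv> lcm_dual (mpoly_ring n) (ferrers_stable_ideal m lam)"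

lemma dual_gens_carrier: "((\<lambda>f. mon (L - f)) ` gens :: 'k::comm_ring_1 pol set) \<subseteq> carrier (mpoly_ring n)"
proof -
  have "Poly_Mapping.keys (L - f) \<subseteq> Poly_Mapping.keys L" for f
    by (auto simp: in_keys_iff lookup_minus)
  then show ?thesis unfolding keys_L by (simp add: image_subset_iff)
qed

lemma dual_eq: "(dual :: 'k::field pol set) = genideal (mpoly_ring n) ((\<lambda>f. mon (L - f)) ` gens)"
  by (simp only: lcm_dual_def gens_lcm_eq min_gens)

lemma ideal_dual: "ideal (dual :: 'k::field pol set) (mpoly_ring n)"
proof -
  interpret cring "mpoly_ring n :: 'k pol ring" by (rule cring_mpoly)
  show ?thesis unfolding dual_eq by (rule genideal_ideal[OF dual_gens_carrier])
qed

text \<open>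
  The \<open>Empty\<close> coordinates of boundaries form an ideal, and the vertices produce its generators.
\<close>

lemma dual_iff: "(x :: 'k::field pol) \<in> dual \<longleftrightarrow> (\<exists>v\<in>F 1. x = d 0 v Empty)"
proof
  interpret cring "mpoly_ring n :: 'k pol ring" by (rule cring_mpoly)
  have gen: "mon (L - f) \<in> (dual :: 'k pol set)" if "f \<in> gens" for f
    using genideal_self[OF dual_gens_carrier] that unfolding dual_eq by blast
  show "x \<in> dual" if im: "\<exists>v\<in>F 1. x = d 0 v Empty"
  proof -
    obtain v :: "cell \<Rightarrow> 'k pol" where v: "v \<in> F 1" "x = (\<Sum>c\<in>cells 1. v c * bd c Empty)"
      using im by (auto simp only: d0_Empty)
    have "v c * bd c Empty \<in> dual" if "c \<in> cells 1" for c
    proof (rule ideal_mpolyD(3)[OF ideal_dual free_coord[OF v(1)]])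
      from that obtain i j where c: "c = Vert i j" "(i, j) \<in> shape" by (auto simp: cells_1)
      then have "ev i + ev j \<in> gens" by (force simp: gens_def)
      from gen[OF this] show "(bd c Empty :: 'k pol) \<in> dual" by (simp add: c(1) unit_vec_def)
    qed
    then show ?thesis unfolding v(2) by (intro ideal_mpolyD(4)[OF ideal_dual])
  qed
  let ?A = "{x :: 'k pol. \<exists>v\<in>F 1. x = d 0 v Empty}"
  have "ideal ?A (mpoly_ring n)"
  proof (rule ideal_mpolyI)
    show "?A \<subseteq> carrier (mpoly_ring n)"
      using d_closed[of _ 0] free_coord by fastforce
    have "(\<lambda>c. 0 :: 'k pol) \<in> F 1" by (simp add: free_carrier mpoly_zero)
    then show "0 \<in> ?A" by (force simp: d_def lin_ext_def)
    show "p + q \<in> ?A" if "p \<in> ?A" "q \<in> ?A" for p q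
    proof -
      from that obtain v w :: "cell \<Rightarrow> 'k pol" where "v \<in> F 1" "w \<in> F 1" "p = d 0 v Empty" "q = d 0 w Empty" by blast
      then have "p + q = d 0 (\<lambda>c. v c + w c) Empty" "(\<lambda>c. v c + w c) \<in> F 1"
        by (simp_all only: d_add free_add)
      then show ?thesis by blast
    qed
    show "r * p \<in> ?A" if "r \<in> carrier (mpoly_ring n)" "p \<in> ?A" for r p
    proof -
      from that obtain v :: "cell \<Rightarrow> 'k pol" where "v \<in> F 1" "p = d 0 v Empty" by blast
      then have "r * p = d 0 (\<lambda>c. r * v c) Empty" "(\<lambda>c. r * v c) \<in> F 1"
        using that(1) by (simp_all only: d_def lin_ext_smult free_smult)
      then show ?thesis by blast
    qed
  qed
  moreover have "(\<lambda>f. mon (L - f)) ` gens \<subseteq> ?A"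
  proof clarify
    fix f assume "f \<in> gens"
    then obtain i j where ij: "(i, j) \<in> shape" "f = ev i + ev j" by (auto simp: gens_def)
    then have "d 0 (unit_vec (Vert i j) 1) Empty = (mon (L - f) :: 'k pol)"
      by (subst d_unit) (auto simp: unit_vec_def)
    moreover have "unit_vec (Vert i j) (1 :: 'k pol) \<in> F 1"
      using ij by (intro free_unit) (simp add: mpoly_one)
    ultimately show "\<exists>v\<in>F 1. (mon (L - f) :: 'k pol) = d 0 v Empty" by metis
  qed
  ultimately have "dual \<subseteq> ?A" unfolding dual_eq by (rule genideal_minimal)
  then show "\<exists>v\<in>F 1. x = d 0 v Empty" if "x \<in> dual" using that by blast
qed

lemma F_trivial: "4 \<le> k \<Longrightarrow> F k = {\<lambda>c. 0 :: 'k::field pol}"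
  by (auto simp: free_carrier cells_ge_4)

text \<open>
  From degree four on all modules are zero, so exactness at the squares is injectivity.
\<close>

lemma exact_step:
  "{u \<in> F (k + 1). d k u = (\<lambda>c. 0 :: 'k::field pol)} = d (k + 1) ` F (k + 2)"
proof -
  consider "k = 0" | "k = 1" | "k = 2" | "3 \<le> k" by linarith
  then show ?thesis
  proof cases
    case 1
    have "{u \<in> F 1. d 0 u = (\<lambda>c. 0 :: 'k pol)} = d 1 ` F 2"
    proof (intro equalityI subsetI)
      fix u :: "cell \<Rightarrow> 'k pol" assume "u \<in> {u \<in> F 1. d 0 u = (\<lambda>c. 0)}"
      then show "u \<in> d 1 ` F 2" using ker_d0[of u] by blast
    qed (use d1_closed d0_d1 in blast)
    then show ?thesis using 1 by (simp add: numeral_2_eq_2)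
  next
    case 2
    have "{u \<in> F 2. d 1 u = (\<lambda>c. 0 :: 'k pol)} = d 2 ` F 3"
    proof (intro equalityI subsetI)
      fix u :: "cell \<Rightarrow> 'k pol" assume "u \<in> {u \<in> F 2. d 1 u = (\<lambda>c. 0)}"
      then show "u \<in> d 2 ` F 3" using ker_d1[of u] by blast
    qed (use d2_closed d1_d2 in blast)
    then show ?thesis using 2 by (simp add: numeral_2_eq_2 numeral_3_eq_3)
  next
    case 3
    have "{u \<in> F 3. d 2 u = (\<lambda>c. 0 :: 'k pol)} = {\<lambda>c. 0}"
      using d2_injective d_zero by (auto simp: free_carrier mpoly_zero)
    moreover have "d 3 ` F 4 = {\<lambda>c. 0 :: 'k pol}"
      using d_zero by (simp add: F_trivial)
    ultimately show ?thesis using 3 by simp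
  next
    case 4
    then show ?thesis by (auto simp: F_trivial d_zero)
  qed
qed

theorem resolution:
  "graded_free_resolution (mpoly_ring n) cells twist d
     (\<lambda>u. dual +>\<^bsub>mpoly_ring n\<^esub> u Empty) (quot_module (mpoly_ring n) (dual :: 'k::field pol set))"
proof -
  interpret R: cring "mpoly_ring n :: 'k pol ring" by (rule cring_mpoly)
  interpret J: ideal "dual :: 'k pol set" "mpoly_ring n" by (rule ideal_dual)
  let ?\<epsilon> = "\<lambda>u :: cell \<Rightarrow> 'k pol. dual +>\<^bsub>mpoly_ring n\<^esub> u Empty"
  let ?Q = "quot_module (mpoly_ring n) (dual :: 'k pol set)"
  note hom = J.rcos_ring_hom
  have F0: "u Empty \<in> carrier (mpoly_ring n)" if "u \<in> F 0" for u :: "cell \<Rightarrow> 'k pol"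
    using free_coord[OF that] .
  have hom_eps: "?\<epsilon> \<in> mod_hom (mpoly_ring n) (free_module (mpoly_ring n) (cells 0)) ?Q"
    unfolding mod_hom_def quot_module_def
    using ring_hom_closed[OF hom] ring_hom_add[OF hom] ring_hom_mult[OF hom]
    by (auto simp: F0)
  have surj: "?\<epsilon> ` F 0 = carrier ?Q"
  proof -
    have "carrier ?Q = (\<lambda>x. dual +>\<^bsub>mpoly_ring n\<^esub> x) ` carrier (mpoly_ring n)"
      by (auto simp: quot_module_def FactRing_def A_RCOSETS_def')
    moreover have "(\<lambda>u. u Empty) ` F 0 = carrier (mpoly_ring n :: 'k pol ring)"
    proof
      show "carrier (mpoly_ring n :: 'k pol ring) \<subseteq> (\<lambda>u. u Empty) ` F 0"
      proof
        fix p :: "'k pol" assume "p \<in> carrier (mpoly_ring n)"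
        then have "unit_vec Empty p \<in> F 0" by (intro free_unit) (simp add: cells_0)
        moreover have "p = unit_vec Empty p Empty" by (simp add: unit_vec_def)
        ultimately show "p \<in> (\<lambda>u. u Empty) ` F 0" by (intro image_eqI[of _ _ "unit_vec Empty p"])
      qed
    qed (use F0 in blast)
    ultimately show ?thesis by (metis image_image)
  qed
  have coset_zero: "dual +>\<^bsub>mpoly_ring n\<^esub> x = dual \<longleftrightarrow> x \<in> dual"
    if "x \<in> carrier (mpoly_ring n)" for x :: "'k pol"
    using that J.a_rcos_const J.a_rcos_self by metis
  have "{u \<in> F 0. ?\<epsilon> u = dual} = d 0 ` F 1"
  proof (intro equalityI subsetI)
    fix u :: "cell \<Rightarrow> 'k pol" assume "u \<in> {u \<in> F 0. ?\<epsilon> u = dual}"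
    then have u: "u \<in> F 0" "u Empty \<in> dual" using coset_zero F0 by auto
    then obtain v where v: "v \<in> F 1" "u Empty = d 0 v Empty" by (auto simp only: dual_iff)
    have "d 0 v \<in> F 0" using d_closed[of v 0] v(1) by simp
    then have "u c = d 0 v c" for c
      using u(1) v(2) by (cases "c = Empty") (auto simp: free_carrier cells_0)
    then show "u \<in> d 0 ` F 1" using v(1) by blast
  next
    fix u :: "cell \<Rightarrow> 'k pol" assume "u \<in> d 0 ` F 1"
    then obtain v where v: "v \<in> F 1" "u = d 0 v" by blast
    then have "u \<in> F 0" using d_closed[of v 0] by simp
    moreover have "u Empty \<in> dual" using v dual_iff by blast
    ultimately show "u \<in> {u \<in> F 0. ?\<epsilon> u = dual}" using coset_zero F0 by auto
  qed
  then have ker_eps: "a_kernel (free_module (mpoly_ring n) (cells 0)) ?Q ?\<epsilon> = d 0 ` F 1"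
    by (simp add: a_kernel_def' quot_module_def FactRing_def)
  show ?thesis
    unfolding graded_free_resolution_def
  proof (intro conjI allI hom_eps surj ker_eps finite_cells)
    show "d k \<in> mod_hom (mpoly_ring n) (free_module (mpoly_ring n) (cells (k + 1))) (free_module (mpoly_ring n) (cells k))"
      for k unfolding d_def by (rule lin_ext_mod_hom[OF bd_closed])
    show "d k ` graded_part (mpoly_ring n) (cells (k + 1)) (twist (k + 1)) e \<subseteq> graded_part (mpoly_ring n) (cells k) (twist k) e"
      for k e unfolding d_def by (rule cellular_graded[OF cellular bd_closed])
    show "a_kernel (free_module (mpoly_ring n) (cells (k + 1))) (free_module (mpoly_ring n) (cells k)) (d k) =
        d (k + 1) ` F (k + 2)" for k
      using exact_step[of k] by (simp add: a_kernel_def')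
  qed
qed

text \<open>
  The twists drop by one at each edge and square, and by \<open>m + n - 2\<close> at the vertices. The latter is zero
  only for \<open>m = n = 1\<close>, where the single vertex has label one.
\<close>

lemma minimal:
  assumes "\<not> (m = 1 \<and> n = 1)"
  shows "minimal_complex n cells (d :: nat \<Rightarrow> (cell \<Rightarrow> 'k::field pol) \<Rightarrow> _)"
  unfolding d_def
proof (rule cellular_minimal[OF cellular bd_closed])
  show "twist (k + 1) < twist k" if "cells (k + 1) \<noteq> {}" for k
  proof -
    have "2 < m + n" using assms m_pos m_le_n by linarith
    moreover have "k < 3" using that cells_ge_4[of "k + 1"] by (cases "k < 3") auto
    then consider "k = 0" | "k = 1" | "k = 2" by linarith
    ultimately show ?thesis by cases (auto simp: twist_def)
  qed
qed

end

theorem theorem4p10: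
  fixes m n :: nat and lam :: "nat \<Rightarrow> nat"
    and R :: "'k::field pol ring" and I :: "'k pol set" and mI :: pp
    and a :: "nat \<Rightarrow> int"
  assumes "1 \<le> m"
    and "\<And>i j. 1 \<le> i \<Longrightarrow> i \<le> j \<Longrightarrow> j \<le> m \<Longrightarrow> lam j \<le> lam i"
    and "m \<le> lam m"
    and "n = lam 1"
    and "R = mpoly_ring n"
    and "I = ferrers_stable_ideal m lam"
    and "mI = gens_lcm R I"
    and "a = (\<lambda>_. 0)(1 := - int m - int n + 2, 2 := - int m - int n + 1, 3 := - int m - int n)"
  shows "cellular_supported (X_cells I) cell_verts (X_label mI) a
           (X_boundary mI :: cell \<Rightarrow> cell \<Rightarrow> 'k pol) \<and>
         graded_free_resolution R (X_cells I) a (X_diff I mI)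
           (\<lambda>u. lcm_dual R I +>\<^bsub>R\<^esub> u Empty) (quot_module R (lcm_dual R I)) \<and>
         (\<not> (m = 1 \<and> n = 1) \<longrightarrow> minimal_complex n (X_cells I) (X_diff I mI))"
proof -
  interpret ferrers_shape m n lam
    using assms(1-4) by unfold_locales auto
  have mI: "mI = L" unfolding assms(5-7) by (rule gens_lcm_eq)
  have cells: "X_cells I = cells" unfolding assms(6) by (rule X_cells_eq)
  have a: "a = twist" by (simp only: assms(8) twist_def)
  have diff: "X_diff I mI = d" by (rule ext) (simp only: X_diff_def d_def cells mI)
  show ?thesis
    unfolding diff unfolding cells unfolding a mI assms(5,6) using cellular resolution minimal by blast
qed

end
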